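(* Let $H$ be a trigraph in which every vertex has a strong loop and whose symmetric graph contains no triangles. Then L-HOM$(H)$ is polynomial time solvable.
   Context: A trigraph $H$ consists of a finite vertex set $V(H)$ and two disjoint sets $W(H)$ (weak edges) and $S(H)$ (strong edges) of ordered pairs of vertices (loops allowed); a strong loop at $x$ means $xx\in S(H)$. The symmetric graph of $H$ is the undirected graph on $V(H)$ in which distinct $x,y$ are adjacent iff both $xy$ and $yx$ lie in $W(H)\cup S(H)$. For a digraph $G$, a homomorphism of $G$ to $H$ is $f:V(G)\to V(H)$ with, for all $u\ne v$, $uv\in E(G)\Rightarrow f(u)f(v)\in W(H)\cup S(H)$ and $uv\notin E(G)\Rightarrow f(u)f(v)\notin S(H)$. With lists $L(u)\subseteq V(H)$, a list $H$-colouring is such a homomorphism with $f(u)\in L(u)$ for all $u$. L-HOM$(H)$: given a digraph $G$ with lists $L$, decide whether a list $H$-colouring exists. *)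

theory Defs
  imports
    "HOL-Computational_Algebra.Polynomial"
    "Graph_Theory.Pair_Digraph"
begin

section \<open>Trigraphs and list homomorphisms\<close>

record 'a trigraph =
  tverts :: "'a set"
  weak :: "'a rel"
  strong :: "'a rel"

locale trigraph =
  fixes H :: "'a trigraph"
  assumes finite_tverts: "finite (tverts H)"
    and weak_subset: "weak H \<subseteq> tverts H \<times> tverts H"
    and strong_subset: "strong H \<subseteq> tverts H \<times> tverts H"
    and weak_strong_disjoint: "weak H \<inter> strong H = {}"

text \<open>An undirected graph is represented by its symmetric, irreflexive set of arcs.\<close>

definition symmetric_graph :: "'a trigraph \<Rightarrow> 'a pair_pre_digraph" where
  "symmetric_graph H =
    \<lparr> pverts = tverts H,
      parcs = {(x, y). x \<in> tverts H \<and> y \<in> tverts H \<and> x \<noteq> y \<and>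
        (x, y) \<in> weak H \<union> strong H \<and> (y, x) \<in> weak H \<union> strong H} \<rparr>"

definition triangle_free :: "'a pair_pre_digraph \<Rightarrow> bool" where
  "triangle_free G \<longleftrightarrow>
    \<not> (\<exists>x y z. x \<noteq> y \<and> y \<noteq> z \<and> x \<noteq> z \<and>
          (x, y) \<in> parcs G \<and> (y, z) \<in> parcs G \<and> (x, z) \<in> parcs G)"

definition trigraph_hom :: "'v pair_pre_digraph \<Rightarrow> 'a trigraph \<Rightarrow> ('v \<Rightarrow> 'a) \<Rightarrow> bool" where
  "trigraph_hom G H f \<longleftrightarrow>
    (\<forall>u\<in>pverts G. f u \<in> tverts H) \<and>
    (\<forall>u\<in>pverts G. \<forall>v\<in>pverts G. u \<noteq> v \<longrightarrow>
      ((u, v) \<in> parcs G \<longrightarrow> (f u, f v) \<in> weak H \<union> strong H) \<and>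
      ((u, v) \<notin> parcs G \<longrightarrow> (f u, f v) \<notin> strong H))"

definition list_colouring ::
  "'v pair_pre_digraph \<Rightarrow> ('v \<Rightarrow> 'a set) \<Rightarrow> 'a trigraph \<Rightarrow> ('v \<Rightarrow> 'a) \<Rightarrow> bool" where
  "list_colouring G L H f \<longleftrightarrow> trigraph_hom G H f \<and> (\<forall>u\<in>pverts G. f u \<in> L u)"

section \<open>Polynomial time\<close>

text \<open>
  Polynomial time is measured on a random access machine with unit cost instructions. Its state
  consists of a program counter, registers and a memory, all holding natural numbers. A program
  mentions only finitely many registers, all by fixed index; the memory is accessed through
  addresses held in registers. The only arithmetic is addition and truncated subtraction, so
  after \<open>t\<close> steps every value has bit length linear in \<open>t\<close> plus the initial bit lengths.
  Hence the unit and the logarithmic cost measure give the same polynomial time languages, which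
  are those of polynomial time Turing machines (with multiplication this would fail).
\<close>

datatype instr =
    Const nat nat       \<comment> \<open>\<open>r\<^sub>d := c\<close>\<close>
  | Add nat nat nat     \<comment> \<open>\<open>r\<^sub>d := r\<^sub>a + r\<^sub>b\<close>\<close>
  | Sub nat nat nat     \<comment> \<open>\<open>r\<^sub>d := r\<^sub>a - r\<^sub>b\<close>, truncated at 0\<close>
  | Load nat nat        \<comment> \<open>\<open>r\<^sub>d := mem[r\<^sub>a]\<close>\<close>
  | Store nat nat       \<comment> \<open>\<open>mem[r\<^sub>a] := r\<^sub>b\<close>\<close>
  | Jump nat
  | JumpZero nat nat    \<comment> \<open>jump to the second argument if the register is 0\<close>

type_synonym program = "instr list"

record config =
  pc :: nat
  reg :: "nat \<Rightarrow> nat"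
  mem :: "nat \<Rightarrow> nat"

fun exec :: "instr \<Rightarrow> config \<Rightarrow> config" where
  "exec (Const d k) c = c\<lparr>pc := Suc (pc c), reg := (reg c)(d := k)\<rparr>"
| "exec (Add d a b) c = c\<lparr>pc := Suc (pc c), reg := (reg c)(d := reg c a + reg c b)\<rparr>"
| "exec (Sub d a b) c = c\<lparr>pc := Suc (pc c), reg := (reg c)(d := reg c a - reg c b)\<rparr>"
| "exec (Load d a) c = c\<lparr>pc := Suc (pc c), reg := (reg c)(d := mem c (reg c a))\<rparr>"
| "exec (Store a b) c = c\<lparr>pc := Suc (pc c), mem := (mem c)(reg c a := reg c b)\<rparr>"
| "exec (Jump l) c = c\<lparr>pc := l\<rparr>"
| "exec (JumpZero a l) c = c\<lparr>pc := (if reg c a = 0 then l else Suc (pc c))\<rparr>"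

definition halted :: "program \<Rightarrow> config \<Rightarrow> bool" where
  "halted P c \<longleftrightarrow> length P \<le> pc c"

definition step :: "program \<Rightarrow> config \<Rightarrow> config" where
  "step P c = (if halted P c then c else exec (P ! pc c) c)"

text \<open>The input word is in memory, its length in register 0; everything else is 0.\<close>

definition init :: "bool list \<Rightarrow> config" where
  "init w =
    \<lparr> pc = 0,
      reg = (\<lambda>_. 0)(0 := length w),
      mem = (\<lambda>i. if i < length w \<and> w ! i then 1 else 0) \<rparr>"

definition accepting :: "config \<Rightarrow> bool" where
  "accepting c \<longleftrightarrow> reg c 0 = 1"

text \<open>
  Halted configurations are fixed points of \<^term>\<open>step P\<close>, so being halted after
  \<^term>\<open>poly p (length w)\<close> iterations means halting within that many steps.
\<close>

definition polynomial_time :: "bool list set \<Rightarrow> bool" where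
  "polynomial_time X \<longleftrightarrow>
    (\<exists>(P :: program) (p :: nat poly). \<forall>w.
      let c = (step P ^^ poly p (length w)) (init w)
      in halted P c \<and> (accepting c \<longleftrightarrow> w \<in> X))"

section \<open>The list homomorphism problem\<close>

text \<open>
  An instance on the vertices \<open>0, \<dots>, n - 1\<close> is encoded by \<open>n\<close> in unary, the adjacency matrix, and
  the characteristic vectors of the lists with respect to an enumeration \<open>hs\<close> of the vertices
  of the fixed trigraph. The code is injective up to the values of \<open>L\<close> outside the vertices of
  \<open>G\<close>.
\<close>

definition encode :: "'a list \<Rightarrow> nat pair_pre_digraph \<Rightarrow> (nat \<Rightarrow> 'a set) \<Rightarrow> bool list" where
  "encode hs G L =
    (let n = card (pverts G) in
      replicate n True @ [False] @
      concat (map (\<lambda>u. map (\<lambda>v. (u, v) \<in> parcs G) [0..<n]) [0..<n]) @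
      concat (map (\<lambda>u. map (\<lambda>x. x \<in> L u) hs) [0..<n]))"

definition L_HOM :: "'a trigraph \<Rightarrow> 'a list \<Rightarrow> bool list set" where
  "L_HOM H hs =
    {encode hs G L | G L.
      pair_fin_digraph G \<and> pverts G = {..<card (pverts G)} \<and>
      (\<forall>u\<in>pverts G. L u \<subseteq> tverts H) \<and>
      (\<exists>f. list_colouring G L H f)}"

definition L_HOM_polynomial_time_solvable :: "'a trigraph \<Rightarrow> bool" where
  "L_HOM_polynomial_time_solvable H \<longleftrightarrow>
    (\<forall>hs. distinct hs \<and> set hs = tverts H \<longrightarrow> polynomial_time (L_HOM H hs))"

end

theory Submission
  imports Defs
begin

text \<open>
  By the strong loops, vertices of one colour are joined in both directions. So once a
  representative is fixed for every colour that occurs, two colours that both remain possible for a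
  vertex are adjacent in the symmetric graph of \<open>H\<close>. As that graph has no
  triangle, at most two colours remain for every vertex. Path consistency solves such an instance,
  because pairwise intersecting subsets of a two-element set have a common element. There are
  polynomially many choices of representatives (\<open>H\<close> is fixed), so it remains to run this algorithm
  on the random access machine. For this, it is written in a language whose only loops range over
  all numbers below the input length, which makes the running time polynomial by structural
  recursion.
\<close>

section \<open>A structured language with polynomial running time\<close>

text \<open>A wrong guess of representatives does no harm: the table still enforces the
  compatibility of all pairs, so every feasible guess yields a genuine solution, and only the guess
  read off an actual solution has to succeed. That guess must also say which colours are absent,
  because an absent colour has no representative to compare with. The language cannot leave a loop
  early, so path consistency runs for \<open>l * l\<close> rounds, where \<open>l\<close> is the
  input length. This exceeds the number of table entries, and rounds after stabilisation change
  nothing. The order of deletions within a round is immaterial, since every closed subtable survives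
  the deletion of an unsupported entry. Only vertices are looped over at run time; iteration over
  colours is unrolled when the program is written.\<close>

datatype tm =
    V nat
  | C nat
  | Len
  | Plus tm tm
  | Minus tm tm
  | Ld tm
  | Cond tm tm tm
  | Sum nat tm

primrec eval :: "nat \<Rightarrow> tm \<Rightarrow> (nat \<Rightarrow> nat) \<Rightarrow> (nat \<Rightarrow> nat) \<Rightarrow> nat" where
  "eval l (V i) e m = e i"
| "eval l (C c) e m = c"
| "eval l Len e m = l"
| "eval l (Plus a b) e m = eval l a e m + eval l b e m"
| "eval l (Minus a b) e m = eval l a e m - eval l b e m"
| "eval l (Ld a) e m = m (eval l a e m)"
| "eval l (Cond a b c) e m = (if eval l a e m \<noteq> 0 then eval l b e m else eval l c e m)"
| "eval l (Sum i t) e m = (\<Sum>j<l. eval l t (e(i := j)) m)"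

datatype com =
    Skip
  | Asg nat tm
  | St tm tm
  | Seq com com
  | For nat com

type_synonym state = "(nat \<Rightarrow> nat) \<times> (nat \<Rightarrow> nat)"

text \<open>The fold sets the loop variable afresh in every round, so there are \<open>l\<close>
  rounds whatever the body does to it. Unlike \<open>Sum\<close>, the loop does not restore the old
  value.\<close>

primrec run :: "nat \<Rightarrow> com \<Rightarrow> state \<Rightarrow> state" where
  "run l Skip = id"
| "run l (Asg i t) = (\<lambda>(e, m). (e(i := eval l t e m), m))"
| "run l (St a b) = (\<lambda>(e, m). (e, m(eval l a e m := eval l b e m)))"
| "run l (Seq c d) = run l d \<circ> run l c"
| "run l (For i c) = fold (\<lambda>j (e, m). run l c (e(i := j), m)) [0..<l]"

text \<open>
  Variable \<open>i\<close> lives in register \<open>2 * i\<close>; the odd registers hold the input length (register 1)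
  and temporaries.
\<close>

definition var :: "nat \<Rightarrow> nat" where
  "var i = 2 * i"

definition tmp :: "nat \<Rightarrow> nat" where
  "tmp d = Suc (2 * d)"

lemma var_tmp_simps [simp]:
  "var i = var j \<longleftrightarrow> i = j" "tmp i = tmp j \<longleftrightarrow> i = j" "var i \<noteq> tmp j" "tmp j \<noteq> var i"
  unfolding var_def tmp_def by presburger+

section \<open>Compilation and time bounds\<close>

primrec len_tm :: "tm \<Rightarrow> nat" where
  "len_tm (V i) = 2"
| "len_tm (C c) = 1"
| "len_tm Len = 2"
| "len_tm (Plus a b) = len_tm a + len_tm b + 1"
| "len_tm (Minus a b) = len_tm a + len_tm b + 1"
| "len_tm (Ld a) = len_tm a + 1"
| "len_tm (Cond a b c) = len_tm a + len_tm b + len_tm c + 2"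
| "len_tm (Sum i t) = len_tm t + 14"

text \<open>The start address \<open>p\<close> is a parameter because jumps are absolute. The
  temporaries form a stack of height \<open>d\<close>: the result goes to \<open>tmp d\<close> and
  everything below survives. A \<open>Const\<close> with 0 followed by \<open>Add\<close> is a move.
  In \<open>Sum\<close>, \<open>tmp d\<close> accumulates, \<open>tmp (Suc d)\<close> counts and
  \<open>tmp (d + 2)\<close> saves the bound variable.\<close>

primrec comp_tm :: "tm \<Rightarrow> nat \<Rightarrow> nat \<Rightarrow> program" where
  "comp_tm (V i) p d = [Const (tmp d) 0, Add (tmp d) (tmp d) (var i)]"
| "comp_tm (C c) p d = [Const (tmp d) c]"
| "comp_tm Len p d = [Const (tmp d) 0, Add (tmp d) (tmp d) (tmp 0)]"
| "comp_tm (Plus a b) p d =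
    comp_tm a p d @ comp_tm b (p + len_tm a) (Suc d) @ [Add (tmp d) (tmp d) (tmp (Suc d))]"
| "comp_tm (Minus a b) p d =
    comp_tm a p d @ comp_tm b (p + len_tm a) (Suc d) @ [Sub (tmp d) (tmp d) (tmp (Suc d))]"
| "comp_tm (Ld a) p d = comp_tm a p d @ [Load (tmp d) (tmp d)]"
| "comp_tm (Cond a b c) p d =
    comp_tm a p d @ [JumpZero (tmp d) (p + len_tm a + len_tm b + 2)] @
    comp_tm b (p + len_tm a + 1) d @ [Jump (p + len_tm a + len_tm b + len_tm c + 2)] @
    comp_tm c (p + len_tm a + len_tm b + 2) d"
| "comp_tm (Sum i t) p d =
    [Const (tmp d) 0, Const (tmp (Suc d)) 0,
     Const (tmp (d + 2)) 0, Add (tmp (d + 2)) (tmp (d + 2)) (var i),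
     Sub (tmp (d + 3)) (tmp 0) (tmp (Suc d)), JumpZero (tmp (d + 3)) (p + len_tm t + 12),
     Const (var i) 0, Add (var i) (var i) (tmp (Suc d))] @
    comp_tm t (p + 8) (d + 3) @
    [Add (tmp d) (tmp d) (tmp (d + 3)), Const (tmp (d + 3)) 1,
     Add (tmp (Suc d)) (tmp (Suc d)) (tmp (d + 3)), Jump (p + 4),
     Const (var i) 0, Add (var i) (var i) (tmp (d + 2))]"

lemma length_comp_tm [simp]: "length (comp_tm t p d) = len_tm t"
  by (induction t arbitrary: p d) auto

text \<open>The polynomial \<open>[:0, 1:]\<close> is the input length. Both branches of
  \<open>Cond\<close> are charged, as an upper bound suffices. In \<open>Sum\<close>, the first 8 is
  4 steps of preparation, 2 for the final test and 2 for restoring the variable; a round takes 2 + 2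
  + 3 + 1 steps besides the body.\<close>

primrec time_tm :: "tm \<Rightarrow> nat poly" where
  "time_tm (V i) = [:2:]"
| "time_tm (C c) = [:1:]"
| "time_tm Len = [:2:]"
| "time_tm (Plus a b) = time_tm a + time_tm b + [:1:]"
| "time_tm (Minus a b) = time_tm a + time_tm b + [:1:]"
| "time_tm (Ld a) = time_tm a + [:1:]"
| "time_tm (Cond a b c) = time_tm a + time_tm b + time_tm c + [:2:]"
| "time_tm (Sum i t) = [:8:] + [:0, 1:] * ([:8:] + time_tm t)"

primrec len_com :: "com \<Rightarrow> nat" where
  "len_com Skip = 0"
| "len_com (Asg i t) = len_tm t + 2"
| "len_com (St a b) = len_tm a + len_tm b + 1"
| "len_com (Seq c d) = len_com c + len_com d"
| "len_com (For i c) = len_com c + 8"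

primrec comp_com :: "com \<Rightarrow> nat \<Rightarrow> nat \<Rightarrow> program" where
  "comp_com Skip p d = []"
| "comp_com (Asg i t) p d = comp_tm t p d @ [Const (var i) 0, Add (var i) (var i) (tmp d)]"
| "comp_com (St a b) p d =
    comp_tm a p d @ comp_tm b (p + len_tm a) (Suc d) @ [Store (tmp d) (tmp (Suc d))]"
| "comp_com (Seq c c') p d = comp_com c p d @ comp_com c' (p + len_com c) d"
| "comp_com (For i c) p d =
    [Const (tmp d) 0,
     Sub (tmp (Suc d)) (tmp 0) (tmp d), JumpZero (tmp (Suc d)) (p + len_com c + 8),
     Const (var i) 0, Add (var i) (var i) (tmp d)] @
    comp_com c (p + 5) (Suc d) @
    [Const (tmp (Suc d)) 1, Add (tmp d) (tmp d) (tmp (Suc d)), Jump (p + 1)]"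

lemma length_comp_com [simp]: "length (comp_com c p d) = len_com c"
  by (induction c arbitrary: p d) auto

primrec time_com :: "com \<Rightarrow> nat poly" where
  "time_com Skip = 0"
| "time_com (Asg i t) = time_tm t + [:2:]"
| "time_com (St a b) = time_tm a + time_tm b + [:1:]"
| "time_com (Seq c d) = time_com c + time_com d"
| "time_com (For i c) = [:3:] + [:0, 1:] * ([:7:] + time_com c)"

section \<open>Correctness of compiled code within a step bound\<close>

definition code_at :: "program \<Rightarrow> nat \<Rightarrow> program \<Rightarrow> bool" where
  "code_at P p Q \<longleftrightarrow> (\<forall>i<length Q. p + i < length P \<and> P ! (p + i) = Q ! i)"

lemma code_at_Nil [simp]: "code_at P p []"
  by (simp add: code_at_def)

lemma code_at_Cons [simp]:
  "code_at P p (i # Q) \<longleftrightarrow> p < length P \<and> P ! p = i \<and> code_at P (Suc p) Q"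
proof -
  have "code_at P p (i # Q) \<longleftrightarrow>
      (\<forall>j. j < Suc (length Q) \<longrightarrow> p + j < length P \<and> P ! (p + j) = (i # Q) ! j)"
    by (simp add: code_at_def)
  also have "\<dots> \<longleftrightarrow> p < length P \<and> P ! p = i \<and> code_at P (Suc p) Q"
    unfolding All_less_Suc2 code_at_def by simp
  finally show ?thesis .
qed

lemma code_at_append [simp]:
  "code_at P p (Q @ R) \<longleftrightarrow> code_at P p Q \<and> code_at P (p + length Q) R"
  by (induction Q arbitrary: p) auto

text \<open>A bound instead of an exact count, since branches differ in length; as halted
  configurations are fixed points, a bound is all that is needed in the end.\<close>

definition reach :: "program \<Rightarrow> nat \<Rightarrow> config \<Rightarrow> config \<Rightarrow> bool" where
  "reach P b c c' \<longleftrightarrow> (\<exists>t\<le>b. (step P ^^ t) c = c')"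

lemma reach_refl: "reach P b c c"
  unfolding reach_def by (rule exI[of _ 0]) simp

lemma reach_trans:
  assumes "reach P a c c'" "reach P b c' c''" "a + b \<le> n"
  shows "reach P n c c''"
proof -
  from assms obtain s t where "s \<le> a" "(step P ^^ s) c = c'" "t \<le> b" "(step P ^^ t) c' = c''"
    by (auto simp: reach_def)
  then have "(step P ^^ (t + s)) c = c''" "t + s \<le> n"
    using assms(3) by (auto simp: funpow_add)
  then show ?thesis
    by (auto simp: reach_def)
qed

lemma reach_step:
  assumes "pc c < length P" "P ! pc c = i" "reach P b (exec i c) c'"
  shows "reach P (Suc b) c c'"
proof -
  have "reach P 1 c (exec i c)"
    unfolding reach_def using assms(1,2) by (intro exI[of _ 1]) (simp add: step_def halted_def)
  from reach_trans[OF this assms(3)] show ?thesis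
    by simp
qed

definition frame :: "nat \<Rightarrow> config \<Rightarrow> config \<Rightarrow> bool" where
  "frame d c c' \<longleftrightarrow> (\<forall>i. reg c' (var i) = reg c (var i)) \<and>
    (\<forall>k<d. reg c' (tmp k) = reg c (tmp k)) \<and> mem c' = mem c"

lemma frame_trans: "frame d c c' \<Longrightarrow> frame d' c' c'' \<Longrightarrow> d \<le> d' \<Longrightarrow> frame d c c''"
  by (simp add: frame_def)

lemma frame_eval: "frame d c c' \<Longrightarrow> eval l t (\<lambda>i. reg c' (var i)) (mem c') = eval l t (\<lambda>i. reg c (var i)) (mem c)"
  by (simp add: frame_def)

definition computes :: "program \<Rightarrow> nat \<Rightarrow> tm \<Rightarrow> nat \<Rightarrow> nat \<Rightarrow> bool" where
  "computes P l t p d \<longleftrightarrow> (\<forall>c. pc c = p \<longrightarrow> reg c (tmp 0) = l \<longrightarrow>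
    (\<exists>c'. reach P (poly (time_tm t) l) c c' \<and> pc c' = p + len_tm t \<and> frame d c c' \<and>
      reg c' (tmp d) = eval l t (\<lambda>i. reg c (var i)) (mem c)))"

lemma computesE:
  assumes "computes P l t p d" "pc c = p" "reg c (tmp 0) = l"
  obtains c' where "reach P (poly (time_tm t) l) c c'" "pc c' = p + len_tm t" "frame d c c'"
    "reg c' (tmp d) = eval l t (\<lambda>i. reg c (var i)) (mem c)"
  using assms unfolding computes_def by blast

fun straight :: "instr \<Rightarrow> bool" where
  "straight (Jump l) = False"
| "straight (JumpZero a l) = False"
| "straight _ = True"

lemma pc_exec_straight: "straight i \<Longrightarrow> pc (exec i c) = Suc (pc c)"
  by (cases i) auto

lemma reach_straight:
  assumes "code_at P (pc c) Q" "list_all straight Q"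
  shows "reach P (length Q) c (fold exec Q c) \<and> pc (fold exec Q c) = pc c + length Q"
  using assms
proof (induction Q arbitrary: c)
  case Nil
  then show ?case
    by (simp add: reach_refl)
next
  case (Cons i Q)
  then have "reach P (length Q) (exec i c) (fold exec Q (exec i c)) \<and>
      pc (fold exec Q (exec i c)) = pc (exec i c) + length Q"
    by (intro Cons.IH) (auto simp: pc_exec_straight)
  with Cons.prems show ?case
    by (auto simp: pc_exec_straight intro: reach_step)
qed

lemma reach_mono: "reach P m c c' \<Longrightarrow> m \<le> n \<Longrightarrow> reach P n c c'"
  by (rule reach_trans[OF _ reach_refl[of P 0]]) simp_all

lemma reach_straightI:
  assumes "code_at P (pc c) Q" "list_all straight Q" "length Q \<le> n"
  shows "reach P n c (fold exec Q c)"
  using reach_mono reach_straight[OF assms(1,2)] assms(3) by blast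

text \<open>Shared by all binary constructs. The second operand is evaluated at stack height
  \<open>Suc d\<close>, so the first result survives in \<open>tmp d\<close>;
  \<open>d \<ge> 1\<close> protects the input length in \<open>tmp 0\<close>.\<close>

lemma computes_pair:
  assumes "computes P l a p d" "computes P l b (p + len_tm a) (Suc d)" "d \<ge> 1"
    and "pc c = p" "reg c (tmp 0) = l"
  obtains c' where "reach P (poly (time_tm a + time_tm b) l) c c'" "pc c' = p + len_tm a + len_tm b"
    "frame d c c'" "reg c' (tmp d) = eval l a (\<lambda>i. reg c (var i)) (mem c)"
    "reg c' (tmp (Suc d)) = eval l b (\<lambda>i. reg c (var i)) (mem c)"
proof -
  obtain c1 where c1: "reach P (poly (time_tm a) l) c c1" "pc c1 = p + len_tm a" "frame d c c1"
      "reg c1 (tmp d) = eval l a (\<lambda>i. reg c (var i)) (mem c)"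
    using computesE[OF assms(1,4,5)] .
  have "reg c1 (tmp 0) = l"
    using c1(3) assms(3,5) by (simp add: frame_def)
  then obtain c2 where c2: "reach P (poly (time_tm b) l) c1 c2"
      "pc c2 = p + len_tm a + len_tm b" "frame (Suc d) c1 c2"
      "reg c2 (tmp (Suc d)) = eval l b (\<lambda>i. reg c1 (var i)) (mem c1)"
    using computesE[OF assms(2) c1(2)] by blast
  show ?thesis
  proof (rule that[of c2])
    show "reach P (poly (time_tm a + time_tm b) l) c c2"
      by (rule reach_trans[OF c1(1) c2(1)]) simp
  qed (use c1 c2 frame_eval[OF c1(3), of l b] in \<open>auto simp: frame_def\<close>)
qed

lemma comp_tm_correct:
  assumes "code_at P p (comp_tm t p d)" "d \<ge> 1"
  shows "computes P l t p d"
  using assms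
proof (induction t arbitrary: p d)
  case (V i)
  then show ?case
    unfolding computes_def
    by (auto intro!: exI[of _ "fold exec (comp_tm (V i) p d) c" for c] reach_straightI simp: frame_def)
next
  case (C x)
  then show ?case
    unfolding computes_def
    by (auto intro!: exI[of _ "fold exec (comp_tm (C x) p d) c" for c] reach_straightI simp: frame_def)
next
  case Len
  then show ?case
    unfolding computes_def
    by (auto intro!: exI[of _ "fold exec (comp_tm Len p d) c" for c] reach_straightI simp: frame_def)
next
  case (Plus a b)
  have ab: "computes P l a p d" "computes P l b (p + len_tm a) (Suc d)"
    using Plus by auto
  show ?case
    unfolding computes_def
  proof (intro allI impI)
    fix c :: config
    assume c: "pc c = p" "reg c (tmp 0) = l"
    obtain c1 where c1: "reach P (poly (time_tm a + time_tm b) l) c c1"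
        "pc c1 = p + len_tm a + len_tm b" "frame d c c1"
        "reg c1 (tmp d) = eval l a (\<lambda>i. reg c (var i)) (mem c)"
        "reg c1 (tmp (Suc d)) = eval l b (\<lambda>i. reg c (var i)) (mem c)"
      using computes_pair[OF ab Plus.prems(2) c] .
    let ?c = "exec (Add (tmp d) (tmp d) (tmp (Suc d))) c1"
    have 2: "reach P 1 c1 ?c"
      using Plus.prems(1) c1(2) by (auto intro!: reach_step reach_refl simp: add_ac)
    show "\<exists>c'. reach P (poly (time_tm (Plus a b)) l) c c' \<and> pc c' = p + len_tm (Plus a b) \<and>
        frame d c c' \<and> reg c' (tmp d) = eval l (Plus a b) (\<lambda>i. reg c (var i)) (mem c)"
      by (rule exI[of _ ?c], intro conjI, rule reach_trans[OF c1(1) 2])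
        (use c1 in \<open>auto simp: frame_def\<close>)
  qed
next
  case (Minus a b)
  have ab: "computes P l a p d" "computes P l b (p + len_tm a) (Suc d)"
    using Minus by auto
  show ?case
    unfolding computes_def
  proof (intro allI impI)
    fix c :: config
    assume c: "pc c = p" "reg c (tmp 0) = l"
    obtain c1 where c1: "reach P (poly (time_tm a + time_tm b) l) c c1"
        "pc c1 = p + len_tm a + len_tm b" "frame d c c1"
        "reg c1 (tmp d) = eval l a (\<lambda>i. reg c (var i)) (mem c)"
        "reg c1 (tmp (Suc d)) = eval l b (\<lambda>i. reg c (var i)) (mem c)"
      using computes_pair[OF ab Minus.prems(2) c] .
    let ?c = "exec (Sub (tmp d) (tmp d) (tmp (Suc d))) c1"
    have 2: "reach P 1 c1 ?c"
      using Minus.prems(1) c1(2) by (auto intro!: reach_step reach_refl simp: add_ac)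
    show "\<exists>c'. reach P (poly (time_tm (Minus a b)) l) c c' \<and> pc c' = p + len_tm (Minus a b) \<and>
        frame d c c' \<and> reg c' (tmp d) = eval l (Minus a b) (\<lambda>i. reg c (var i)) (mem c)"
      by (rule exI[of _ ?c], intro conjI, rule reach_trans[OF c1(1) 2])
        (use c1 in \<open>auto simp: frame_def\<close>)
  qed
next
  case (Ld a)
  show ?case
    unfolding computes_def
  proof (intro allI impI)
    fix c :: config
    assume c: "pc c = p" "reg c (tmp 0) = l"
    have a: "computes P l a p d"
      using Ld by auto
    obtain c1 where c1: "reach P (poly (time_tm a) l) c c1" "pc c1 = p + len_tm a" "frame d c c1"
        "reg c1 (tmp d) = eval l a (\<lambda>i. reg c (var i)) (mem c)"
      using computesE[OF a c] by blast
    let ?c = "exec (Load (tmp d) (tmp d)) c1"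
    have 2: "reach P 1 c1 ?c"
      using Ld.prems(1) c1(2) by (auto intro!: reach_step reach_refl simp: add_ac)
    show "\<exists>c'. reach P (poly (time_tm (Ld a)) l) c c' \<and> pc c' = p + len_tm (Ld a) \<and>
        frame d c c' \<and> reg c' (tmp d) = eval l (Ld a) (\<lambda>i. reg c (var i)) (mem c)"
      by (rule exI[of _ ?c], intro conjI, rule reach_trans[OF c1(1) 2])
        (use c1 in \<open>auto simp: frame_def\<close>)
  qed
next
  case (Cond a b b')
  show ?case
    unfolding computes_def
  proof (intro allI impI)
    fix c :: config
    assume c: "pc c = p" "reg c (tmp 0) = l"
    have "computes P l a p d" "computes P l b (p + len_tm a + 1) d"
        "computes P l b' (p + len_tm a + len_tm b + 2) d"
      using Cond by (auto simp: add_ac)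
    note abc = this
    obtain c1 where c1: "reach P (poly (time_tm a) l) c c1" "pc c1 = p + len_tm a" "frame d c c1"
        "reg c1 (tmp d) = eval l a (\<lambda>i. reg c (var i)) (mem c)"
      using computesE[OF abc(1) c] by blast
    let ?c2 = "exec (JumpZero (tmp d) (p + len_tm a + len_tm b + 2)) c1"
    have 2: "reach P 1 c1 ?c2"
      using Cond.prems(1) c1(2) by (auto intro!: reach_step reach_refl simp: add_ac)
    have l: "reg ?c2 (tmp 0) = l" and fr2: "frame d c ?c2"
      using c1(3) c(2) Cond.prems(2) by (simp_all add: frame_def)
    show "\<exists>c'. reach P (poly (time_tm (Cond a b b')) l) c c' \<and> pc c' = p + len_tm (Cond a b b') \<and>
        frame d c c' \<and> reg c' (tmp d) = eval l (Cond a b b') (\<lambda>i. reg c (var i)) (mem c)"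
    proof (cases "eval l a (\<lambda>i. reg c (var i)) (mem c) = 0")
      case True
      then have "pc ?c2 = p + len_tm a + len_tm b + 2"
        using c1 by simp
      from computesE[OF abc(3) this l] obtain c3 where
        c3: "reach P (poly (time_tm b') l) ?c2 c3"
          "pc c3 = p + len_tm a + len_tm b + 2 + len_tm b'"
          "frame d ?c2 c3" "reg c3 (tmp d) = eval l b' (\<lambda>i. reg ?c2 (var i)) (mem ?c2)" .
      show ?thesis
        by (rule exI[of _ c3], intro conjI,
            rule reach_trans[OF reach_trans[OF c1(1) 2 order_refl] c3(1)])
          (use True c3 frame_eval[OF fr2, of l b'] frame_trans[OF fr2 c3(3)] in auto)
    next
      case False
      then have "pc ?c2 = p + len_tm a + 1"
        using c1 by simp
      from computesE[OF abc(2) this l] obtain c3 where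
        c3: "reach P (poly (time_tm b) l) ?c2 c3" "pc c3 = p + len_tm a + 1 + len_tm b"
          "frame d ?c2 c3" "reg c3 (tmp d) = eval l b (\<lambda>i. reg ?c2 (var i)) (mem ?c2)" .
      let ?c = "exec (Jump (p + len_tm a + len_tm b + len_tm b' + 2)) c3"
      have 4: "reach P 1 c3 ?c"
        using Cond.prems(1) c3(2) by (auto intro!: reach_step reach_refl simp: add_ac)
      show ?thesis
        by (rule exI[of _ ?c], intro conjI,
            rule reach_trans[OF reach_trans[OF reach_trans[OF c1(1) 2 order_refl] c3(1) order_refl] 4])
          (use False c3 frame_eval[OF fr2, of l b] frame_trans[OF fr2 c3(3)] in \<open>auto simp: frame_def\<close>)
    qed
  qed
next
  case (Sum i t)
  let ?T = "poly (time_tm t) l"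
  have t: "computes P l t (p + 8) (d + 3)"
    using Sum by (auto simp: add_ac numeral_eq_Suc)
  show ?case
    unfolding computes_def
  proof (intro allI impI)
    fix c :: config
    assume c: "pc c = p" "reg c (tmp 0) = l"
    define e where "e = (\<lambda>i. reg c (var i))"
    \<comment> \<open>Variable \<open>i\<close> is exempt because every round overwrites it. Its old
      value waits in \<open>tmp (d + 2)\<close>, out of reach of the body, which works from
      \<open>d + 3\<close> upwards.\<close>
    define Inv where "Inv j c' \<longleftrightarrow> mem c' = mem c \<and> (\<forall>i'. i' \<noteq> i \<longrightarrow> reg c' (var i') = e i') \<and>
      (\<forall>k<d. reg c' (tmp k) = reg c (tmp k)) \<and>
      reg c' (tmp d) = (\<Sum>j<j. eval l t (e(i := j)) (mem c)) \<and>
      reg c' (tmp (Suc d)) = j \<and> reg c' (tmp (d + 2)) = e i"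
      for j and c' :: config
    have iter: "\<exists>c2. reach P (8 + ?T) c1 c2 \<and> pc c2 = p + 4 \<and> Inv (Suc j) c2"
      if c1: "pc c1 = p + 4" "Inv j c1" "j < l" for c1 j
    proof -
      have l1: "reg c1 (tmp 0) = l"
        using c1(2) c(2) Sum.prems(2) by (simp add: Inv_def)
      define c2 where "c2 = exec (JumpZero (tmp (d + 3)) (p + len_tm t + 12))
        (exec (Sub (tmp (d + 3)) (tmp 0) (tmp (Suc d))) c1)"
      have 1: "reach P 2 c1 c2"
        unfolding c2_def numeral_2_eq_2
        using Sum.prems(1) c1(1)
        by (intro reach_step[OF _ _ reach_step[OF _ _ reach_refl]]) (auto simp: add_ac numeral_eq_Suc)
      have c2: "pc c2 = p + 6" "reg c2 (tmp 0) = l" "Inv j c2"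
        using c1 l1 Sum.prems(2) by (auto simp: c2_def Inv_def)
      define Q where "Q = [Const (var i) 0, Add (var i) (var i) (tmp (Suc d))]"
      define c3 where "c3 = fold exec Q c2"
      have 2: "reach P 2 c2 c3"
        unfolding c3_def Q_def
        by (rule reach_straightI)
          (use Sum.prems(1) c2(1) in \<open>auto simp: add_ac numeral_eq_Suc\<close>)
      have c3: "pc c3 = p + 8" "reg c3 (tmp 0) = l" "Inv j c3" "reg c3 (var i) = j"
        using c2 Sum.prems(2) by (auto simp: c3_def Q_def Inv_def)
      obtain c4 where c4: "reach P ?T c3 c4" "pc c4 = p + 8 + len_tm t" "frame (d + 3) c3 c4"
          "reg c4 (tmp (d + 3)) = eval l t (\<lambda>i. reg c3 (var i)) (mem c3)"
        using computesE[OF t c3(1,2)] .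
      have "(\<lambda>i. reg c3 (var i)) = e(i := j)"
        using c3(3,4) by (auto simp: Inv_def)
      then have val: "reg c4 (tmp (d + 3)) = eval l t (e(i := j)) (mem c)"
        using c4(4) c3(3) by (simp add: Inv_def)
      have Inv4: "Inv j c4"
        using c3(3) c4(3) by (simp add: Inv_def frame_def)
      define Q' where "Q' = [Add (tmp d) (tmp d) (tmp (d + 3)), Const (tmp (d + 3)) 1,
        Add (tmp (Suc d)) (tmp (Suc d)) (tmp (d + 3))]"
      define c5 where "c5 = fold exec Q' c4"
      have 3: "reach P 3 c4 c5"
        unfolding c5_def Q'_def
        by (rule reach_straightI)
          (use Sum.prems(1) c4(2) in \<open>auto simp: add_ac numeral_eq_Suc\<close>)
      have c5: "pc c5 = p + len_tm t + 11" "Inv (Suc j) c5"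
        using c4(2) Inv4 val Sum.prems(2) by (auto simp: c5_def Q'_def Inv_def)
      define c6 where "c6 = exec (Jump (p + 4)) c5"
      have 4: "reach P 1 c5 c6"
        using Sum.prems(1) c5(1) unfolding c6_def
        by (auto intro!: reach_step reach_refl simp: add_ac numeral_eq_Suc)
      have "pc c6 = p + 4" "Inv (Suc j) c6"
        using c5(2) by (auto simp: c6_def Inv_def)
      moreover have "reach P (8 + ?T) c1 c6"
        by (rule reach_trans[OF reach_trans[OF reach_trans[OF reach_trans[OF 1 2 order_refl]
              c4(1) order_refl] 3 order_refl] 4]) simp
      ultimately show ?thesis
        by blast
    qed
    define Q0 where "Q0 = [Const (tmp d) 0, Const (tmp (Suc d)) 0,
      Const (tmp (d + 2)) 0, Add (tmp (d + 2)) (tmp (d + 2)) (var i)]"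
    define c0 where "c0 = fold exec Q0 c"
    have c0: "reach P 4 c c0"
      unfolding c0_def Q0_def
      by (rule reach_straightI)
        (use Sum.prems(1) c(1) in \<open>auto simp: add_ac numeral_eq_Suc\<close>)
    have "\<exists>c'. reach P (4 + j * (8 + ?T)) c c' \<and> pc c' = p + 4 \<and> Inv j c'" if "j \<le> l" for j
      using that
    proof (induction j)
      case 0
      have "pc c0 = p + 4" "Inv 0 c0"
        using c by (auto simp: c0_def Q0_def Inv_def e_def)
      with c0 show ?case
        by auto
    next
      case (Suc j)
      then obtain c1 where c1: "reach P (4 + j * (8 + ?T)) c c1" "pc c1 = p + 4" "Inv j c1"
        by auto
      from iter[OF c1(2,3)] Suc.prems obtain c2 where
        "reach P (8 + ?T) c1 c2" "pc c2 = p + 4" "Inv (Suc j) c2"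
        by auto
      moreover from reach_trans[OF c1(1) this(1)] have "reach P (4 + Suc j * (8 + ?T)) c c2"
        by simp
      ultimately show ?case
        by blast
    qed
    then obtain c1 where c1: "reach P (4 + l * (8 + ?T)) c c1" "pc c1 = p + 4" "Inv l c1"
      by blast
    have l1: "reg c1 (tmp 0) = l"
      using c1(3) c(2) Sum.prems(2) by (simp add: Inv_def)
    define c2 where "c2 = exec (JumpZero (tmp (d + 3)) (p + len_tm t + 12))
      (exec (Sub (tmp (d + 3)) (tmp 0) (tmp (Suc d))) c1)"
    have 1: "reach P 2 c1 c2"
      unfolding c2_def numeral_2_eq_2
      using Sum.prems(1) c1(2)
      by (intro reach_step[OF _ _ reach_step[OF _ _ reach_refl]]) (auto simp: add_ac numeral_eq_Suc)
    have c2: "pc c2 = p + len_tm t + 12" "Inv l c2"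
      using c1 l1 Sum.prems(2) by (auto simp: c2_def Inv_def)
    define Q where "Q = [Const (var i) 0, Add (var i) (var i) (tmp (d + 2))]"
    define c3 where "c3 = fold exec Q c2"
    have 2: "reach P 2 c2 c3"
      unfolding c3_def Q_def
      by (rule reach_straightI)
        (use Sum.prems(1) c2(1) in \<open>auto simp: add_ac numeral_eq_Suc\<close>)
    have c3: "pc c3 = p + len_tm (Sum i t)" "frame d c c3"
        "reg c3 (tmp d) = eval l (Sum i t) e (mem c)"
      using c2 by (auto simp: c3_def Q_def Inv_def frame_def e_def)
    have "reach P (poly (time_tm (Sum i t)) l) c c3"
      by (rule reach_trans[OF reach_trans[OF c1(1) 1 order_refl] 2]) simp
    with c3 show "\<exists>c'. reach P (poly (time_tm (Sum i t)) l) c c' \<and> pc c' = p + len_tm (Sum i t) \<and>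
        frame d c c' \<and> reg c' (tmp d) = eval l (Sum i t) (\<lambda>i. reg c (var i)) (mem c)"
      unfolding e_def by blast
  qed
qed

definition executes :: "program \<Rightarrow> nat \<Rightarrow> com \<Rightarrow> nat \<Rightarrow> nat \<Rightarrow> bool" where
  "executes P l s p d \<longleftrightarrow> (\<forall>c. pc c = p \<longrightarrow> reg c (tmp 0) = l \<longrightarrow>
    (\<exists>c'. reach P (poly (time_com s) l) c c' \<and> pc c' = p + len_com s \<and>
      (\<lambda>i. reg c' (var i), mem c') = run l s (\<lambda>i. reg c (var i), mem c) \<and>
      (\<forall>k<d. reg c' (tmp k) = reg c (tmp k))))"

lemma executesE:
  assumes "executes P l s p d" "pc c = p" "reg c (tmp 0) = l"
  obtains c' where "reach P (poly (time_com s) l) c c'" "pc c' = p + len_com s"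
    "(\<lambda>i. reg c' (var i), mem c') = run l s (\<lambda>i. reg c (var i), mem c)"
    "\<And>k. k < d \<Longrightarrow> reg c' (tmp k) = reg c (tmp k)"
  using assms unfolding executes_def by blast

lemma comp_com_correct:
  assumes "code_at P p (comp_com s p d)" "d \<ge> 1"
  shows "executes P l s p d"
  using assms
proof (induction s arbitrary: p d)
  case Skip
  show ?case
    by (auto simp: executes_def intro: reach_refl)
next
  case (Asg i t)
  have t: "computes P l t p d"
    using Asg by (intro comp_tm_correct) auto
  show ?case
    unfolding executes_def
  proof (intro allI impI)
    fix c :: config
    assume c: "pc c = p" "reg c (tmp 0) = l"
    obtain c1 where c1: "reach P (poly (time_tm t) l) c c1" "pc c1 = p + len_tm t" "frame d c c1"
        "reg c1 (tmp d) = eval l t (\<lambda>i. reg c (var i)) (mem c)"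
      using computesE[OF t c] .
    let ?Q = "[Const (var i) 0, Add (var i) (var i) (tmp d)]"
    have 2: "reach P 2 c1 (fold exec ?Q c1)"
      by (rule reach_straightI) (use Asg.prems(1) c1(2) in \<open>auto simp: add_ac\<close>)
    show "\<exists>c'. reach P (poly (time_com (Asg i t)) l) c c' \<and> pc c' = p + len_com (Asg i t) \<and>
      (\<lambda>i. reg c' (var i), mem c') = run l (Asg i t) (\<lambda>i. reg c (var i), mem c) \<and>
      (\<forall>k<d. reg c' (tmp k) = reg c (tmp k))"
      by (rule exI, intro conjI, rule reach_trans[OF c1(1) 2])
        (use c1 in \<open>auto simp: frame_def\<close>)
  qed
next
  case (St a b)
  have ab: "computes P l a p d" "computes P l b (p + len_tm a) (Suc d)"
    using St by (auto intro!: comp_tm_correct)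
  show ?case
    unfolding executes_def
  proof (intro allI impI)
    fix c :: config
    assume c: "pc c = p" "reg c (tmp 0) = l"
    obtain c1 where c1: "reach P (poly (time_tm a + time_tm b) l) c c1"
        "pc c1 = p + len_tm a + len_tm b" "frame d c c1"
        "reg c1 (tmp d) = eval l a (\<lambda>i. reg c (var i)) (mem c)"
        "reg c1 (tmp (Suc d)) = eval l b (\<lambda>i. reg c (var i)) (mem c)"
      using computes_pair[OF ab St.prems(2) c] .
    let ?c = "exec (Store (tmp d) (tmp (Suc d))) c1"
    have 2: "reach P 1 c1 ?c"
      using St.prems(1) c1(2) by (auto intro!: reach_step reach_refl simp: add_ac)
    show "\<exists>c'. reach P (poly (time_com (St a b)) l) c c' \<and> pc c' = p + len_com (St a b) \<and>
      (\<lambda>i. reg c' (var i), mem c') = run l (St a b) (\<lambda>i. reg c (var i), mem c) \<and>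
      (\<forall>k<d. reg c' (tmp k) = reg c (tmp k))"
      by (rule exI, intro conjI, rule reach_trans[OF c1(1) 2])
        (use c1 in \<open>auto simp: frame_def\<close>)
  qed
next
  case (Seq s s')
  have ss: "executes P l s p d" "executes P l s' (p + len_com s) d"
    using Seq by auto
  show ?case
    unfolding executes_def
  proof (intro allI impI)
    fix c :: config
    assume c: "pc c = p" "reg c (tmp 0) = l"
    obtain c1 where c1: "reach P (poly (time_com s) l) c c1" "pc c1 = p + len_com s"
        "(\<lambda>i. reg c1 (var i), mem c1) = run l s (\<lambda>i. reg c (var i), mem c)"
        "\<And>k. k < d \<Longrightarrow> reg c1 (tmp k) = reg c (tmp k)"
      using executesE[OF ss(1) c] by metis
    have "reg c1 (tmp 0) = l"
      using c1(4) c(2) Seq.prems(2) by simp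
    then obtain c2 where c2: "reach P (poly (time_com s') l) c1 c2"
        "pc c2 = p + len_com s + len_com s'"
        "(\<lambda>i. reg c2 (var i), mem c2) = run l s' (\<lambda>i. reg c1 (var i), mem c1)"
        "\<And>k. k < d \<Longrightarrow> reg c2 (tmp k) = reg c1 (tmp k)"
      using executesE[OF ss(2) c1(2)] by metis
    show "\<exists>c'. reach P (poly (time_com (Seq s s')) l) c c' \<and> pc c' = p + len_com (Seq s s') \<and>
      (\<lambda>i. reg c' (var i), mem c') = run l (Seq s s') (\<lambda>i. reg c (var i), mem c) \<and>
      (\<forall>k<d. reg c' (tmp k) = reg c (tmp k))"
      by (rule exI, intro conjI, rule reach_trans[OF c1(1) c2(1)])
        (use c1(2-4) c2(2-4) in auto)
  qed
next
  case (For i s)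
  let ?T = "poly (time_com s) l"
  have s: "executes P l s (p + 5) (Suc d)"
    using For by (auto simp: add_ac numeral_eq_Suc)
  show ?case
    unfolding executes_def
  proof (intro allI impI)
    fix c :: config
    assume c: "pc c = p" "reg c (tmp 0) = l"
    \<comment> \<open>The state after \<open>j\<close> rounds; the number of rounds is detached from
      \<open>l\<close> to allow induction on it while the body still runs with parameter
      \<open>l\<close>.\<close>
    define st where "st j = fold (\<lambda>j (e, m). run l s (e(i := j), m)) [0..<j]
      (\<lambda>i. reg c (var i), mem c)" for j
    have st_Suc: "st (Suc j) = run l s ((fst (st j))(i := j), snd (st j))" for j
      by (simp add: st_def case_prod_beta)
    define Inv where "Inv j c' \<longleftrightarrow> (\<lambda>i. reg c' (var i), mem c') = st j \<and>
      (\<forall>k<d. reg c' (tmp k) = reg c (tmp k)) \<and> reg c' (tmp d) = j" for j and c' :: config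
    \<comment> \<open>Subtraction is truncated, so the tested register is 0 exactly when the counter
      has reached \<open>l\<close>. The same two instructions serve every round and the
      exit.\<close>
    have test: "\<exists>c2. reach P 2 c1 c2 \<and>
        pc c2 = (if j < l then p + 3 else p + len_com (For i s)) \<and> Inv j c2"
      if c1: "pc c1 = p + 1" "Inv j c1" for c1 j
    proof -
      have l1: "reg c1 (tmp 0) = l"
        using c1(2) c(2) For.prems(2) by (simp add: Inv_def)
      define c2 where "c2 = exec (JumpZero (tmp (Suc d)) (p + len_com s + 8))
        (exec (Sub (tmp (Suc d)) (tmp 0) (tmp d)) c1)"
      have "reach P 2 c1 c2"
        unfolding c2_def numeral_2_eq_2
        using For.prems(1) c1(1)
        by (intro reach_step[OF _ _ reach_step[OF _ _ reach_refl]]) (auto simp: add_ac numeral_eq_Suc)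
      moreover have "pc c2 = (if j < l then p + 3 else p + len_com (For i s))" "Inv j c2"
        using c1 l1 For.prems(2) by (auto simp: c2_def Inv_def)
      ultimately show ?thesis
        by blast
    qed
    have iter: "\<exists>c2. reach P (7 + ?T) c1 c2 \<and> pc c2 = p + 1 \<and> Inv (Suc j) c2"
      if c1: "pc c1 = p + 1" "Inv j c1" "j < l" for c1 j
    proof -
      obtain c2 where 1: "reach P 2 c1 c2" and c2: "pc c2 = p + 3" "Inv j c2"
        using test[OF c1(1,2)] c1(3) by auto
      define Q where "Q = [Const (var i) 0, Add (var i) (var i) (tmp d)]"
      define c3 where "c3 = fold exec Q c2"
      have 2: "reach P 2 c2 c3"
        unfolding c3_def Q_def
        by (rule reach_straightI)
          (use For.prems(1) c2(1) in \<open>auto simp: add_ac numeral_eq_Suc\<close>)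
      have c3: "pc c3 = p + 5" "reg c3 (tmp 0) = l" "\<forall>k<d. reg c3 (tmp k) = reg c (tmp k)"
          "reg c3 (tmp d) = j"
        using c2 c(2) For.prems(2) by (auto simp: c3_def Q_def Inv_def)
      have "(\<lambda>i. reg c2 (var i)) = fst (st j)" "mem c2 = snd (st j)"
        using c2(2) unfolding Inv_def by (metis fst_conv snd_conv)+
      moreover have "(\<lambda>i'. reg c3 (var i')) = (\<lambda>i. reg c2 (var i))(i := j)" "mem c3 = mem c2"
        using c2(2) by (auto simp: c3_def Q_def Inv_def)
      ultimately have st3: "(\<lambda>i. reg c3 (var i), mem c3) = ((fst (st j))(i := j), snd (st j))"
        by simp
      obtain c4 where c4: "reach P ?T c3 c4" "pc c4 = p + 5 + len_com s"
          "(\<lambda>i. reg c4 (var i), mem c4) = run l s (\<lambda>i. reg c3 (var i), mem c3)"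
          "\<And>k. k < Suc d \<Longrightarrow> reg c4 (tmp k) = reg c3 (tmp k)"
        using executesE[OF s c3(1,2)] by metis
      have st4: "(\<lambda>i. reg c4 (var i), mem c4) = st (Suc j)"
        unfolding st_Suc c4(3) st3 ..
      define Q' where "Q' = [Const (tmp (Suc d)) 1, Add (tmp d) (tmp d) (tmp (Suc d))]"
      define c5 where "c5 = fold exec Q' c4"
      have 3: "reach P 2 c4 c5"
        unfolding c5_def Q'_def
        by (rule reach_straightI)
          (use For.prems(1) c4(2) in \<open>auto simp: add_ac numeral_eq_Suc\<close>)
      have c5: "pc c5 = p + len_com s + 7" "Inv (Suc j) c5"
        using c4(2,4) c3 st4 by (auto simp: c5_def Q'_def Inv_def)
      define c6 where "c6 = exec (Jump (p + 1)) c5"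
      have 4: "reach P 1 c5 c6"
        using For.prems(1) c5(1) unfolding c6_def
        by (auto intro!: reach_step reach_refl simp: add_ac numeral_eq_Suc)
      have "pc c6 = p + 1" "Inv (Suc j) c6"
        using c5(2) by (auto simp: c6_def Inv_def)
      moreover have "reach P (7 + ?T) c1 c6"
        by (rule reach_trans[OF reach_trans[OF reach_trans[OF reach_trans[OF 1 2 order_refl]
              c4(1) order_refl] 3 order_refl] 4]) simp
      ultimately show ?thesis
        by blast
    qed
    have "\<exists>c'. reach P (1 + j * (7 + ?T)) c c' \<and> pc c' = p + 1 \<and> Inv j c'" if "j \<le> l" for j
      using that
    proof (induction j)
      case 0
      let ?c = "exec (Const (tmp d) 0) c"
      have "reach P 1 c ?c"
        using For.prems(1) c(1) by (auto intro!: reach_step reach_refl)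
      moreover have "pc ?c = p + 1" "Inv 0 ?c"
        using c by (auto simp: Inv_def st_def)
      ultimately show ?case
        by auto
    next
      case (Suc j)
      then obtain c1 where c1: "reach P (1 + j * (7 + ?T)) c c1" "pc c1 = p + 1" "Inv j c1"
        by auto
      from iter[OF c1(2,3)] Suc.prems obtain c2 where
        "reach P (7 + ?T) c1 c2" "pc c2 = p + 1" "Inv (Suc j) c2"
        by auto
      moreover from reach_trans[OF c1(1) this(1)] have "reach P (1 + Suc j * (7 + ?T)) c c2"
        by simp
      ultimately show ?case
        by blast
    qed
    then obtain c1 where c1: "reach P (1 + l * (7 + ?T)) c c1" "pc c1 = p + 1" "Inv l c1"
      by blast
    obtain c2 where c2: "reach P 2 c1 c2" "pc c2 = p + len_com (For i s)" "Inv l c2"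
      using test[OF c1(2,3)] by auto
    have "reach P (poly (time_com (For i s)) l) c c2"
      by (rule reach_trans[OF c1(1) c2(1)]) simp
    with c2 show "\<exists>c'. reach P (poly (time_com (For i s)) l) c c' \<and>
      pc c' = p + len_com (For i s) \<and>
      (\<lambda>i. reg c' (var i), mem c') = run l (For i s) (\<lambda>i. reg c (var i), mem c) \<and>
      (\<forall>k<d. reg c' (tmp k) = reg c (tmp k))"
      by (auto simp: Inv_def st_def)
  qed
qed

lemma step_halted: "halted P c \<Longrightarrow> (step P ^^ n) c = c"
  by (induction n) (simp_all add: step_def)

theorem polynomial_time_if_run:
  assumes "\<And>w. fst (run (length w) s
      ((\<lambda>_. 0)(0 := length w), \<lambda>i. if i < length w \<and> w ! i then 1 else 0)) 0 = 1 \<longleftrightarrow> w \<in> X"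
  shows "polynomial_time X"
proof -
  \<comment> \<open>Register 0, where \<open>init\<close> puts the length and
    \<open>accepting\<close> looks for the answer, is \<open>var 0\<close>. The two leading
    instructions copy it to \<open>tmp 0\<close>, where compiled code expects it; hence start
    address 2 and stack height 1.\<close>
  define P where "P = [Const (tmp 0) 0, Add (tmp 0) (tmp 0) (var 0)] @ comp_com s 2 1"
  define p where "p = [:2:] + time_com s"
  have "halted P c \<and> (accepting c \<longleftrightarrow> w \<in> X)"
    if c_def: "c = (step P ^^ poly p (length w)) (init w)" for w c
  proof -
    let ?l = "length w"
    have code: "code_at P 0 P"
      by (simp add: code_at_def)
    let ?c1 = "fold exec [Const (tmp 0) 0, Add (tmp 0) (tmp 0) (var 0)] (init w)"
    have 1: "reach P 2 (init w) ?c1"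
      by (rule reach_straightI) (use code in \<open>auto simp: P_def init_def\<close>)
    have c1: "pc ?c1 = 2" "reg ?c1 (tmp 0) = ?l"
      by (auto simp: init_def tmp_def var_def)
    have env: "(\<lambda>i. reg ?c1 (var i)) = (\<lambda>_. 0)(0 := ?l)"
      by (rule ext) (auto simp: init_def tmp_def var_def)
    have "executes P ?l s 2 1"
      by (rule comp_com_correct) (use code in \<open>simp_all add: P_def numeral_2_eq_2\<close>)
    from executesE[OF this c1] obtain c2 where
      c2: "reach P (poly (time_com s) ?l) ?c1 c2" "pc c2 = 2 + len_com s"
        "(\<lambda>i. reg c2 (var i), mem c2) = run ?l s (\<lambda>i. reg ?c1 (var i), mem ?c1)"
      by metis
    have "reach P (poly p ?l) (init w) c2"
      by (rule reach_trans[OF 1 c2(1)]) (simp add: p_def)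
    then obtain t where t: "t \<le> poly p ?l" "(step P ^^ t) (init w) = c2"
      by (auto simp: reach_def)
    have halt: "halted P c2"
      using c2(2) by (simp add: halted_def P_def)
    \<comment> \<open>What remains of the time budget is spent in the halted configuration
      \<open>c2\<close>.\<close>
    have "c = (step P ^^ (poly p ?l - t)) c2"
      using t c_def by (metis funpow_add le_add_diff_inverse2 o_apply)
    then have "c = c2"
      using step_halted[OF halt] by simp
    moreover have "reg c2 0 = fst (run ?l s
        ((\<lambda>_. 0)(0 := ?l), \<lambda>i. if i < ?l \<and> w ! i then 1 else 0)) 0"
    proof -
      have "mem ?c1 = (\<lambda>i. if i < ?l \<and> w ! i then 1 else 0)"
        by (simp add: init_def)
      then have "fst (\<lambda>i. reg c2 (var i), mem c2) 0 = fst (run ?l s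
        ((\<lambda>_. 0)(0 := ?l), \<lambda>i. if i < ?l \<and> w ! i then 1 else 0)) 0"
        unfolding c2(3) env by simp
      then show ?thesis
        by (simp add: var_def)
    qed
    ultimately show ?thesis
      using halt assms[of w] by (simp add: accepting_def)
  qed
  then show ?thesis
    unfolding polynomial_time_def Let_def by blast
qed

section \<open>Path consistency\<close>

type_synonym table = "(nat \<times> nat \<times> nat \<times> nat) set"

text \<open>Vertices and colours are numbers; \<open>A\<close> will be the union of the weak and
  strong edges, \<open>S\<close> the strong edges. \<open>l\<close> is the length of the code of the
  instance, the range of every loop.\<close>

locale list_partition =
  fixes n k l :: nat and adj lst A S :: "nat \<Rightarrow> nat \<Rightarrow> bool"
  assumes S_refl: "x < k \<Longrightarrow> S x x"
    and no_triangle: "\<lbrakk>x < k; y < k; z < k; x \<noteq> y; y \<noteq> z; x \<noteq> z;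
      A x y; A y x; A y z; A z y; A x z; A z x\<rbrakk> \<Longrightarrow> False"
    and l_eq: "l = n + 1 + n * n + n * k"
begin

section \<open>Solutions, guessed representatives and closed tables\<close>

definition compat :: "nat \<Rightarrow> nat \<Rightarrow> nat \<Rightarrow> nat \<Rightarrow> bool" where
  "compat u x v y \<longleftrightarrow> (if adj u v then A x y else \<not> S x y)"

definition solution :: "(nat \<Rightarrow> nat) \<Rightarrow> bool" where
  "solution f \<longleftrightarrow> (\<forall>u<n. f u < k \<and> lst u (f u) \<and> (\<forall>v<n. u \<noteq> v \<longrightarrow> compat u (f u) v (f v)))"

text \<open>\<open>g x = n\<close> (or more) means that colour \<open>x\<close> is guessed not to occur.\<close>

definition possible :: "(nat \<Rightarrow> nat) \<Rightarrow> nat \<Rightarrow> nat \<Rightarrow> bool" where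
  "possible g u x \<longleftrightarrow> lst u x \<and> g x < n \<and>
    (\<forall>y<k. g y < n \<longrightarrow> (if u = g y then x = y else compat u x (g y) y \<and> compat (g y) y u x))"

text \<open>The diagonal entries \<open>(u, x, u, x)\<close> stand for the lists, so unary and
  binary constraints live in one table.\<close>

definition T0 :: "(nat \<Rightarrow> nat) \<Rightarrow> table" where
  "T0 g = {(u, x, v, y). u < n \<and> v < n \<and> x < k \<and> y < k \<and> possible g u x \<and> possible g v y \<and>
    (if u = v then x = y else compat u x v y \<and> compat v y u x)}"

text \<open>Since \<open>w\<close> may be \<open>u\<close> or \<open>v\<close>, a supported entry of
  a subtable of \<open>T0 g\<close> also has the diagonal entries of both its ends in that
  subtable.\<close>

definition unsupported :: "table \<Rightarrow> nat \<times> nat \<times> nat \<times> nat \<Rightarrow> bool" where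
  "unsupported T = (\<lambda>(u, x, v, y). \<exists>w<n. \<not> (\<exists>z<k. (u, x, w, z) \<in> T \<and> (v, y, w, z) \<in> T))"

definition closed :: "table \<Rightarrow> bool" where
  "closed T \<longleftrightarrow> (\<forall>q\<in>T. \<not> unsupported T q)"

text \<open>Asking for some closed subtable instead of the greatest one keeps the correctness
  argument independent of how it is computed.\<close>

definition feasible :: "(nat \<Rightarrow> nat) \<Rightarrow> bool" where
  "feasible g \<longleftrightarrow> (\<exists>T. closed T \<and> T \<subseteq> T0 g \<and> (\<forall>u<n. \<exists>x<k. (u, x, u, x) \<in> T))"

text \<open>Compare \<open>u\<close> with the representative of \<open>x\<close>. If they are the
  same vertex, then \<open>y = x\<close>. Otherwise colour \<open>x\<close> on both is compatible
  only if both arcs are present, because \<open>S x x\<close>; these arcs then turn the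
  compatibility of \<open>y\<close> at \<open>u\<close> with \<open>x\<close> at \<open>g x\<close>
  into \<open>A y x\<close> and \<open>A x y\<close>.\<close>

lemma possible_adjacent:
  assumes "possible g u x" "possible g u y" "x < k" "y < k" "x \<noteq> y"
  shows "A x y \<and> A y x"
proof -
  have gx: "g x < n"
    using assms(1) by (simp add: possible_def)
  have x: "u = g x \<or> compat u x (g x) x \<and> compat (g x) x u x"
    using assms(1,3) gx unfolding possible_def by meson
  have "if u = g x then y = x else compat u y (g x) x \<and> compat (g x) x u y"
    using assms(2,3) gx unfolding possible_def by blast
  with x assms(5) have "compat u x (g x) x" "compat (g x) x u x" "compat u y (g x) x" "compat (g x) x u y"
    by (auto split: if_splits)
  then show ?thesis
    using S_refl[OF assms(3)] by (auto simp: compat_def split: if_splits)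
qed

lemma possible_at_most_two:
  assumes "possible g u x" "possible g u y" "possible g u z" "x < k" "y < k" "z < k"
  shows "x = y \<or> y = z \<or> x = z"
  using possible_adjacent assms no_triangle by metis

text \<open>\<open>D\<close> is a set of at most two elements, given without naming them. Failing
  candidates would produce three: \<open>a\<close> fails at \<open>u1\<close>, \<open>b\<close> lies
  in the sets of \<open>u0\<close> and \<open>u1\<close> but fails at \<open>u2\<close>, and
  \<open>d\<close> lies in those of \<open>u1\<close> and \<open>u2\<close>, so they are pairwise
  distinct.\<close>

lemma helly_two:
  assumes "\<And>u v. u \<in> I \<Longrightarrow> v \<in> I \<Longrightarrow> \<exists>z. P u z \<and> P v z"
    and "\<And>u z. u \<in> I \<Longrightarrow> P u z \<Longrightarrow> D z"
    and "\<And>x y z. D x \<Longrightarrow> D y \<Longrightarrow> D z \<Longrightarrow> x = y \<or> y = z \<or> x = z"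
    and "I \<noteq> {}"
  shows "\<exists>z. \<forall>u\<in>I. P u z"
proof (rule ccontr)
  assume no: "\<not> ?thesis"
  obtain u0 where u0: "u0 \<in> I"
    using assms(4) by blast
  obtain a where a: "P u0 a"
    using assms(1)[OF u0 u0] by blast
  obtain u1 where u1: "u1 \<in> I" "\<not> P u1 a"
    using no by blast
  obtain b where b: "P u0 b" "P u1 b"
    using assms(1)[OF u0 u1(1)] by blast
  obtain u2 where u2: "u2 \<in> I" "\<not> P u2 b"
    using no by blast
  obtain d where d: "P u1 d" "P u2 d"
    using assms(1)[OF u1(1) u2(1)] by blast
  have "D a" "D b" "D d"
    using assms(2) u0 u1 a b d by blast+
  with assms(3)[of a b d] u1(2) u2(2) b d show False
    by auto
qed

text \<open>The colours at \<open>m\<close> supported by the earlier vertices intersect pairwise by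
  closedness, so \<open>helly_two\<close> finds a common one. Only pairs with
  \<open>u \<le> v\<close> are tracked, as a closed table need not be symmetric; vertex 0 has no
  predecessor and takes its colour from \<open>start\<close>.\<close>

lemma closed_extends:
  assumes T: "closed T" "T \<subseteq> T0 g" and start: "\<forall>u<n. \<exists>x<k. (u, x, u, x) \<in> T"
  shows "m \<le> n \<Longrightarrow> \<exists>f. \<forall>v<m. \<forall>u\<le>v. (u, f u, v, f v) \<in> T"
proof (induction m)
  case 0
  show ?case by simp
next
  case (Suc m)
  then obtain f where f: "\<And>u v. u \<le> v \<Longrightarrow> v < m \<Longrightarrow> (u, f u, v, f v) \<in> T"
    by auto
  have m: "m < n"
    using Suc.prems by simp
  have sup: "\<exists>z<k. (u, x, w, z) \<in> T \<and> (v, y, w, z) \<in> T" if "(u, x, v, y) \<in> T" "w < n" for u x v y w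
    using T(1) that unfolding closed_def unsupported_def by blast
  have "\<exists>z. (\<forall>u<m. (u, f u, m, z) \<in> T) \<and> (m, z, m, z) \<in> T"
  proof (cases "m = 0")
    case True
    with start m show ?thesis
      by auto
  next
    case False
    have "\<exists>z. \<forall>u\<in>{..<m}. (u, f u, m, z) \<in> T"
    proof (rule helly_two[where D = "\<lambda>z. possible g m z \<and> z < k"])
      show "\<exists>z. (u, f u, m, z) \<in> T \<and> (v, f v, m, z) \<in> T" if "u \<in> {..<m}" "v \<in> {..<m}" for u v
      proof (cases "u \<le> v")
        case True
        with f[OF True] sup[OF _ m] that show ?thesis by blast
      next
        case False
        with f[of v u] sup[OF _ m] that show ?thesis by (metis lessThan_iff linear)
      qed
      show "x = y \<or> y = z \<or> x = z" if "possible g m x \<and> x < k" "possible g m y \<and> y < k" "possible g m z \<and> z < k" for x y z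
        using possible_at_most_two that by blast
    qed (use T(2) False in \<open>auto simp: T0_def\<close>)
    then obtain z where z: "\<And>u. u < m \<Longrightarrow> (u, f u, m, z) \<in> T"
      by auto
    from z[of 0] False have "(0, f 0, m, z) \<in> T"
      by simp
    \<comment> \<open>Support with \<open>w = m\<close> yields the diagonal entry, because
      \<open>T0\<close> allows only equal colours at equal vertices.\<close>
    from sup[OF this m] obtain z' where "(m, z, m, z') \<in> T"
      by blast
    moreover from this T(2) have "z' = z"
      by (auto simp: T0_def)
    ultimately show ?thesis
      using z by blast
  qed
  then obtain z where "\<forall>u<m. (u, f u, m, z) \<in> T" "(m, z, m, z) \<in> T"
    by blast
  with f show ?case
    by (intro exI[of _ "f(m := z)"]) (auto simp: less_Suc_eq le_less)
qed

lemma feasible_imp_solution: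
  assumes "feasible g"
  shows "\<exists>f. solution f"
proof -
  from assms obtain T where T: "closed T" "T \<subseteq> T0 g" "\<forall>u<n. \<exists>x<k. (u, x, u, x) \<in> T"
    by (auto simp: feasible_def)
  from closed_extends[OF this order_refl] obtain f where
    f: "(u, f u, v, f v) \<in> T0 g" if "u \<le> v" "v < n" for u v
    using T(2) by blast
  \<comment> \<open>The tracked pairs have \<open>u \<le> v\<close>, but \<open>T0\<close> records
    compatibility in both directions.\<close>
  have "compat u (f u) v (f v)" if "u < n" "v < n" "u \<noteq> v" for u v
    using f[of u v] f[of v u] that by (cases "u \<le> v") (auto simp: T0_def)
  moreover have "f u < k \<and> lst u (f u)" if "u < n" for u
    using f[OF order_refl that] by (auto simp: T0_def possible_def)
  ultimately show ?thesis
    by (auto simp: solution_def)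
qed

text \<open>Representatives are chosen from the colour classes of \<open>f\<close>. The values
  prescribed by \<open>h\<close> beyond \<open>k\<close> match the way the program stores a guess:
  it is read off the whole environment, of which only the first \<open>k\<close> guess variables are
  varied.\<close>

lemma solution_imp_feasible:
  assumes "solution f"
  shows "\<exists>g. (\<forall>x<k. g x < l) \<and> (\<forall>x\<ge>k. g x = h x) \<and> feasible g"
proof -
  \<comment> \<open>The value \<open>n\<close> marks an absent colour; it is among the values tried
    because \<open>n < l\<close>.\<close>
  define g where "g x = (if x < k then if \<exists>u<n. f u = x then SOME u. u < n \<and> f u = x else n else h x)" for x
  have g: "f (g x) = x \<or> g x = n" "g x \<le> n" if "x < k" for x
  proof -
    have "g x = n \<or> g x < n \<and> f (g x) = x"
      using that someI_ex[of "\<lambda>u. u < n \<and> f u = x"] by (auto simp: g_def)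
    then show "f (g x) = x \<or> g x = n" "g x \<le> n"
      by auto
  qed
  have g': "g (f u) < n" if "u < n" for u
    using that assms someI[of "\<lambda>v. v < n \<and> f v = f u" u] by (auto simp: g_def solution_def)
  have possible: "possible g u (f u)" if "u < n" for u
  proof -
    have "if u = g y then f u = y else compat u (f u) (g y) y \<and> compat (g y) y u (f u)"
      if "y < k" "g y < n" for y
    proof -
      have "f (g y) = y"
        using g(1)[OF that(1)] that(2) by auto
      with that(2) \<open>u < n\<close> assms show ?thesis
        unfolding solution_def by metis
    qed
    with that assms g'[OF that] show ?thesis
      unfolding possible_def solution_def by blast
  qed
  \<comment> \<open>The pairs of values of one solution form a closed table: \<open>w\<close> is
    always supported by \<open>f w\<close>.\<close>
  let ?T = "{(u, f u, v, f v) | u v. u < n \<and> v < n}"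
  have "closed ?T"
    using assms by (auto simp: closed_def unsupported_def solution_def)
  moreover have "?T \<subseteq> T0 g"
    using assms possible by (auto simp: T0_def solution_def)
  moreover have "\<forall>u<n. \<exists>x<k. (u, x, u, x) \<in> ?T"
    using assms by (auto simp: solution_def)
  ultimately have "feasible g"
    unfolding feasible_def by blast
  moreover have "n < l"
    by (simp add: l_eq)
  then have "\<forall>x<k. g x < l"
    using g(2) le_less_trans by blast
  moreover have "\<forall>x\<ge>k. g x = h x"
    by (simp add: g_def)
  ultimately show ?thesis
    by blast
qed

text \<open>
  What a pass over the entries \<open>Q\<close> that deletes unsupported entries in place does to a table; no
  deletion order has to be tracked, since a pass without deletions certifies that \<open>Q\<close> has no unsupported entry.
\<close>

definition sweep :: "table \<Rightarrow> table \<Rightarrow> table \<Rightarrow> bool" where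
  "sweep Q T T' \<longleftrightarrow> T' \<subseteq> T \<and> (\<forall>F. closed F \<longrightarrow> F \<subseteq> T \<longrightarrow> F \<subseteq> T') \<and>
    (T' = T \<longrightarrow> (\<forall>q\<in>Q \<inter> T. \<not> unsupported T q))"

lemma sweep_empty: "sweep {} T T"
  by (simp add: sweep_def)

text \<open>If two passes together change nothing, neither does each of them, by the inclusions; so
  both certificates speak about the same table.\<close>

lemma sweep_trans:
  assumes "sweep Q T T'" "sweep Q' T' T''"
  shows "sweep (Q \<union> Q') T T''"
proof -
  have sub: "T'' \<subseteq> T'" "T' \<subseteq> T"
    using assms by (auto simp: sweep_def)
  have "F \<subseteq> T''" if "closed F" "F \<subseteq> T" for F
    using assms that unfolding sweep_def by simp
  moreover have "\<forall>q\<in>(Q \<union> Q') \<inter> T. \<not> unsupported T q" if "T'' = T"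
  proof -
    have "T' = T" "T'' = T'"
      using sub that by auto
    with assms show ?thesis
      by (auto simp: sweep_def)
  qed
  ultimately show ?thesis
    using sub by (auto simp: sweep_def)
qed

text \<open>Support is lost, never gained, when a table shrinks, so an entry unsupported in
  \<open>T\<close> lies in no closed subset of \<open>T\<close>. The redundant \<open>insert\<close>
  matches the effect of writing a nonzero memory cell.\<close>

lemma sweep_single: "sweep {q} T (if q \<in> T \<and> \<not> unsupported T q then insert q T else T - {q})"
proof -
  have "unsupported F q" if "unsupported T q" "F \<subseteq> T" for F
    using that unfolding unsupported_def by (cases q) blast
  then show ?thesis
    by (auto simp: sweep_def closed_def)
qed

section \<open>Convergence of repeated sweeps\<close>

definition progress :: "(nat \<Rightarrow> nat) \<Rightarrow> nat \<Rightarrow> table \<Rightarrow> bool" where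
  "progress g r T \<longleftrightarrow> T \<subseteq> T0 g \<and> (\<forall>F. closed F \<longrightarrow> F \<subseteq> T0 g \<longrightarrow> F \<subseteq> T) \<and>
    (closed T \<or> card T + r \<le> card (T0 g))"

lemma T0_subset: "T0 g \<subseteq> {..<n} \<times> {..<k} \<times> {..<n} \<times> {..<k}"
  by (auto simp: T0_def)

lemma finite_T0: "finite (T0 g)"
  by (rule finite_subset[OF T0_subset]) auto

text \<open>The bound is strict and of a form that two nested loops can count; at
  \<open>r = l * l\<close> it rules out the second alternative in \<open>progress\<close>.\<close>

lemma card_T0: "card (T0 g) < l * l"
proof -
  have "card (T0 g) \<le> card ({..<n} \<times> {..<k} \<times> {..<n} \<times> {..<k})"
    by (rule card_mono[OF _ T0_subset]) auto
  also have "\<dots> = (n * k) * (n * k)"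
    by (simp add: card_cartesian_product)
  also have "\<dots> < l * l"
    by (rule mult_strict_mono) (auto simp: l_eq)
  finally show ?thesis .
qed

lemma progress_start: "progress g 0 (T0 g)"
  by (simp add: progress_def)

text \<open>A full sweep either removes an entry, which pays for the round, or changes nothing and
  thereby certifies that the table is closed.\<close>

lemma progress_step:
  assumes "progress g r T" "sweep Q T T'" "T0 g \<subseteq> Q"
  shows "progress g (Suc r) T'"
proof -
  have sub: "T' \<subseteq> T" "T \<subseteq> T0 g"
    using assms by (auto simp: progress_def sweep_def)
  have "closed T' \<or> card T' + Suc r \<le> card (T0 g)"
  proof (cases "T' = T")
    case True
    moreover from this assms(2) have "\<forall>q\<in>Q \<inter> T. \<not> unsupported T q"
      by (simp add: sweep_def)
    moreover have "Q \<inter> T = T"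
      using sub assms(3) by auto
    ultimately have "closed T'"
      by (simp add: closed_def)
    then show ?thesis ..
  next
    case False
    \<comment> \<open>A closed \<open>T\<close> is itself among the tables \<open>F\<close> that a
      sweep preserves.\<close>
    then have "\<not> closed T"
      using assms(2) sub by (auto simp: sweep_def)
    moreover have "card T' < card T"
      using False sub finite_T0 by (intro psubset_card_mono) (auto intro: finite_subset)
    ultimately show ?thesis
      using assms(1) by (auto simp: progress_def)
  qed
  moreover have "F \<subseteq> T'" if "closed F" "F \<subseteq> T0 g" for F
    using assms(1,2) that unfolding progress_def sweep_def by simp
  ultimately show ?thesis
    using sub by (simp add: progress_def)
qed

lemma progress_end:
  assumes "progress g (l * l) T"
  shows "(\<forall>u<n. \<exists>x<k. (u, x, u, x) \<in> T) \<longleftrightarrow> feasible g"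
proof
  have "closed T" "T \<subseteq> T0 g"
    using assms card_T0[of g] by (auto simp: progress_def)
  then show "feasible g" if "\<forall>u<n. \<exists>x<k. (u, x, u, x) \<in> T"
    using that by (auto simp: feasible_def)
next
  assume "feasible g"
  then obtain T' where T': "closed T'" "T' \<subseteq> T0 g" "\<forall>u<n. \<exists>x<k. (u, x, u, x) \<in> T'"
    by (auto simp: feasible_def)
  then have "T' \<subseteq> T"
    using assms by (simp add: progress_def)
  with T'(3) show "\<forall>u<n. \<exists>x<k. (u, x, u, x) \<in> T"
    by blast
qed

end

section \<open>The program\<close>

primrec assigned :: "com \<Rightarrow> nat set" where
  "assigned Skip = {}"
| "assigned (Asg i t) = {i}"
| "assigned (St a b) = {}"
| "assigned (Seq c d) = assigned c \<union> assigned d"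
| "assigned (For i c) = insert i (assigned c)"

lemma run_For_induct:
  assumes "P 0 s"
    and "\<And>j e m. j < l \<Longrightarrow> P j (e, m) \<Longrightarrow> P (Suc j) (run l c (e(i := j), m))"
  shows "P l (run l (For i c) s)"
proof -
  have "j \<le> l \<Longrightarrow> P j (fold (\<lambda>j (e, m). run l c (e(i := j), m)) [0..<j] s)" for j
    by (induction j) (use assms in \<open>auto split: prod.split\<close>)
  then show ?thesis
    by simp
qed

lemma run_not_assigned:
  assumes "i \<notin> assigned c"
  shows "fst (run l c s) i = fst s i"
  using assms
proof (induction c arbitrary: s)
  case (For j c)
  show ?case
    by (rule run_For_induct[where P = "\<lambda>_ s'. fst s' i = fst s i"]) (use For in auto)
qed (auto split: prod.splits)

section \<open>Truth values and arithmetic as terms\<close>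

definition tnot :: "tm \<Rightarrow> tm" where "tnot a = Cond a (C 0) (C 1)"

definition tand :: "tm \<Rightarrow> tm \<Rightarrow> tm" where "tand a b = Cond a b (C 0)"

definition tall :: "tm list \<Rightarrow> tm" where "tall ts = foldr tand ts (C 1)"

definition tany :: "tm list \<Rightarrow> tm" where "tany ts = foldr Plus ts (C 0)"

text \<open>A separate name lets the simplifier argue with \<open>holds\<close> instead of unfolding
  \<open>eval\<close> of \<open>Cond\<close>.\<close>

definition tif :: "tm \<Rightarrow> tm \<Rightarrow> tm \<Rightarrow> tm" where "tif = Cond"

definition tbool :: "bool \<Rightarrow> tm" where "tbool b = C (of_bool b)"

definition tless :: "tm \<Rightarrow> tm \<Rightarrow> tm" where "tless a b = Minus b a"

definition teq :: "tm \<Rightarrow> tm \<Rightarrow> tm" where "teq a b = tnot (Plus (Minus a b) (Minus b a))"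

text \<open>Counts the counterexamples below the input length; smaller ranges need a guard in the
  body.\<close>

definition tforall :: "nat \<Rightarrow> tm \<Rightarrow> tm" where "tforall i t = tnot (Sum i (tnot t))"

definition tmul :: "tm \<Rightarrow> tm \<Rightarrow> tm" where "tmul a b = Sum 9 (Cond (tless (V 9) a) b (C 0))"

abbreviation holds :: "nat \<Rightarrow> tm \<Rightarrow> (nat \<Rightarrow> nat) \<Rightarrow> (nat \<Rightarrow> nat) \<Rightarrow> bool" where
  "holds l t e m \<equiv> eval l t e m > 0"

lemma holds_simps [simp]:
  "holds l (tnot a) e m \<longleftrightarrow> \<not> holds l a e m"
  "holds l (tand a b) e m \<longleftrightarrow> holds l a e m \<and> holds l b e m"
  "holds l (tless a b) e m \<longleftrightarrow> eval l a e m < eval l b e m"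
  "holds l (teq a b) e m \<longleftrightarrow> eval l a e m = eval l b e m"
  "holds l (tif a b c) e m \<longleftrightarrow> (if holds l a e m then holds l b e m else holds l c e m)"
  "holds l (tbool P) e m \<longleftrightarrow> P"
  "holds l (tforall i a) e m \<longleftrightarrow> (\<forall>j<l. holds l a (e(i := j)) m)"
  by (auto simp: tnot_def tand_def tless_def teq_def tforall_def
    tif_def tbool_def)

lemma holds_tall [simp]: "holds l (tall ts) e m \<longleftrightarrow> (\<forall>t\<in>set ts. holds l t e m)"
proof -
  have "holds l (foldr tand ts (C 1)) e m \<longleftrightarrow> (\<forall>t\<in>set ts. holds l t e m)"
    by (induction ts) auto
  then show ?thesis
    by (simp add: tall_def)
qed

lemma holds_tany [simp]: "holds l (tany ts) e m \<longleftrightarrow> (\<exists>t\<in>set ts. holds l t e m)"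
proof -
  have "holds l (foldr Plus ts (C 0)) e m \<longleftrightarrow> (\<exists>t\<in>set ts. holds l t e m)"
    by (induction ts) auto
  then show ?thesis
    by (simp add: tany_def)
qed

lemma sum_less_const: "p \<le> l \<Longrightarrow> (\<Sum>j<l. if j < p then c else 0 :: nat) = p * c"
proof -
  assume "p \<le> l"
  then have "{..<l} \<inter> {j. j < p} = {..<p}"
    by auto
  then show ?thesis
    by (simp flip: sum.inter_restrict add: sum.If_cases)
qed

text \<open>The sum adds \<open>b\<close> once for each value below \<open>a\<close>, which is a
  product only if these values fit below \<open>l\<close>. The premises for all \<open>j\<close> say
  that neither factor depends on variable 9, which the sum binds.\<close>

lemma eval_tmul:
  assumes "\<And>j. eval l a (e(9 := j)) m = p" "\<And>j. eval l b (e(9 := j)) m = q" "p \<le> l"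
  shows "eval l (tmul a b) e m = p * q"
  using assms by (simp add: tmul_def tless_def sum_less_const not_le cong: if_cong)

section \<open>Memory layout of the table\<close>

definition addr :: "nat \<Rightarrow> nat \<Rightarrow> nat \<times> nat \<times> nat \<times> nat \<Rightarrow> nat" where
  "addr k l = (\<lambda>(u, x, v, y). l + (((x * k + y) * l + u) * l + v))"

lemma mult_add_inject:
  fixes a b c d l :: nat
  assumes "b < l" "d < l" "a * l + b = c * l + d"
  shows "a = c \<and> b = d"
proof -
  have "(a * l + b) div l = a" "(c * l + d) div l = c" "(a * l + b) mod l = b" "(c * l + d) mod l = d"
    using assms(1,2) by auto
  then show ?thesis
    using assms(3) by metis
qed

lemma addr_inject:
  assumes "u < l" "v < l" "x < k" "y < k" "u' < l" "v' < l" "x' < k" "y' < k"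
  shows "addr k l (u, x, v, y) = addr k l (u', x', v', y') \<longleftrightarrow> (u, x, v, y) = (u', x', v', y')"
proof
  assume "addr k l (u, x, v, y) = addr k l (u', x', v', y')"
  then have "((x * k + y) * l + u) * l + v = ((x' * k + y') * l + u') * l + v'"
    by (simp only: addr_def prod.case add_left_cancel)
  from mult_add_inject[OF _ _ this] assms have "(x * k + y) * l + u = (x' * k + y') * l + u'" "v = v'"
    by blast+
  moreover from mult_add_inject[OF _ _ this(1)] assms have "x * k + y = x' * k + y'" "u = u'"
    by blast+
  moreover from mult_add_inject[OF _ _ this(1)] assms have "x = x'" "y = y'"
    by blast+
  ultimately show "(u, x, v, y) = (u', x', v', y')"
    by simp
qed simp

text \<open>A sum whose summand ignores variable 9 multiplies by the input length. This dictates the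
  digit order in \<open>addr\<close>: the colour part \<open>x * k + y\<close> is a constant of the
  program and leads, so the Horner scheme multiplies by \<open>l\<close> only. The offset
  \<open>Len\<close> skips the input.\<close>

definition addr_tm :: "nat \<Rightarrow> tm \<Rightarrow> nat \<Rightarrow> tm \<Rightarrow> nat \<Rightarrow> tm" where
  "addr_tm k u x v y = Plus Len (Plus (Sum 9 (Plus (Sum 9 (C (x * k + y))) u)) v)"

lemma eval_addr_tm [simp]:
  "i \<noteq> 9 \<Longrightarrow> eval l (addr_tm k (V i) x (V j) y) e m = addr k l (e i, x, e j, y)"
  by (simp add: addr_tm_def addr_def algebra_simps)

fun seqs :: "com list \<Rightarrow> com" where
  "seqs [] = Skip"
| "seqs (c # cs) = Seq c (seqs cs)"

text \<open>
  Variables: 1 holds the number of vertices, 2 whether the input is well formed, 3 the result,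
  4 and 5 the vertices of a table entry, 6 and 7 count rounds, 8 is a quantified vertex, 9 is bound
  in products, and \<open>11 + x\<close> holds the representative guessed for colour \<open>x\<close>.
\<close>

definition table_com :: "nat \<Rightarrow> (nat \<Rightarrow> nat \<Rightarrow> tm) \<Rightarrow> com" where
  "table_com k val = For 4 (For 5 (seqs (map (\<lambda>(x, y). St (addr_tm k (V 4) x (V 5) y) (val x y))
    (List.product [0..<k] [0..<k]))))"

definition adj_tm :: "tm \<Rightarrow> tm \<Rightarrow> tm" where
  "adj_tm u v = Ld (Plus (Plus (V 1) (C 1)) (Plus (tmul u (V 1)) v))"

definition lst_tm :: "nat \<Rightarrow> tm \<Rightarrow> nat \<Rightarrow> tm" where
  "lst_tm k u x = Ld (Plus (Plus (V 1) (C 1)) (Plus (tmul (V 1) (V 1)) (Plus (tmul u (C k)) (C x))))"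

definition wf_tm :: "nat \<Rightarrow> tm \<Rightarrow> tm" where
  "wf_tm k i = tall [teq Len (Plus (Plus i (C 1)) (Plus (tmul i i) (tmul i (C k)))),
    tnot (Ld i), tforall 8 (tnot (tand (tless (V 8) i) (tnot (Ld (V 8)))))]"

text \<open>At most one number passes \<open>wf_tm\<close>, namely the position of the first zero,
  so the sum acts as a search for it.\<close>

definition vertices_tm :: "nat \<Rightarrow> tm" where
  "vertices_tm k = Sum 10 (Cond (wf_tm k (V 10)) (V 10) (C 0))"

definition valid_tm :: "nat \<Rightarrow> tm" where
  "valid_tm k = Sum 10 (wf_tm k (V 10))"

primrec guesses :: "com \<Rightarrow> nat \<Rightarrow> com" where
  "guesses c 0 = c"
| "guesses c (Suc x) = For (11 + x) (guesses c x)"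

definition check_tm :: "nat \<Rightarrow> tm" where
  "check_tm k = tforall 4 (tnot (tand (tless (V 4) (V 1))
    (tnot (tany (map (\<lambda>x. Ld (addr_tm k (V 4) x (V 4) x)) [0..<k])))))"

definition upd_tm :: "nat \<Rightarrow> nat \<Rightarrow> nat \<Rightarrow> tm" where
  "upd_tm k x y = tand (Ld (addr_tm k (V 4) x (V 5) y))
    (tforall 8 (tnot (tand (tless (V 8) (V 1))
      (tnot (tany (map (\<lambda>z. tand (Ld (addr_tm k (V 4) x (V 8) z)) (Ld (addr_tm k (V 5) y (V 8) z)))
        [0..<k]))))))"

context
  fixes k :: nat and A S :: "nat \<Rightarrow> nat \<Rightarrow> bool"
begin

text \<open>For fixed colours the edges of the trigraph are constants of the program; only the arcs
  of the instance are read from memory.\<close>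

definition compat_tm :: "tm \<Rightarrow> nat \<Rightarrow> tm \<Rightarrow> nat \<Rightarrow> tm" where
  "compat_tm u x v y = tif (adj_tm u v) (tbool (A x y)) (tbool (\<not> S x y))"

definition possible_tm :: "tm \<Rightarrow> nat \<Rightarrow> tm" where
  "possible_tm u x = tall ([lst_tm k u x, tless (V (11 + x)) (V 1)] @
    map (\<lambda>y. tif (tless (V (11 + y)) (V 1))
      (tif (teq u (V (11 + y))) (tbool (x = y))
        (tand (compat_tm u x (V (11 + y)) y) (compat_tm (V (11 + y)) y u x)))
      (tbool True)) [0..<k])"

definition init_tm :: "nat \<Rightarrow> nat \<Rightarrow> tm" where
  "init_tm x y = tall [tless (V 4) (V 1), tless (V 5) (V 1), possible_tm (V 4) x, possible_tm (V 5) y,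
    tif (teq (V 4) (V 5)) (tbool (x = y))
      (tand (compat_tm (V 4) x (V 5) y) (compat_tm (V 5) y (V 4) x))]"

text \<open>The table is rebuilt for each guess, while variable 3 accumulates and stays positive
  after one success.\<close>

definition inner_com :: com where
  "inner_com = Seq (table_com k init_tm) (Seq (For 6 (For 7 (table_com k (upd_tm k))))
    (Asg 3 (Plus (V 3) (check_tm k))))"

text \<open>The last assignment normalises the answer, since acceptance demands exactly 1.\<close>

definition main_com :: com where
  "main_com = Seq (Asg 1 (vertices_tm k))
    (Seq (Asg 2 (valid_tm k))
    (Seq (guesses inner_com k)
    (Asg 0 (Cond (V 2) (Cond (V 3) (C 1) (C 0)) (C 0)))))"

end

lemma assigned_table [simp]: "assigned (table_com k val) = {4, 5}"
proof -
  have "assigned (seqs (map (\<lambda>(x, y). St (a x y) (b x y)) ps)) = {}" for a b and ps :: "(nat \<times> nat) list"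
    by (induction ps) auto
  then show ?thesis
    by (auto simp: table_com_def)
qed

lemma assigned_guesses: "assigned (guesses c x) = assigned c \<union> {11..<11 + x}"
proof (induction x)
  case (Suc x)
  then show ?case
    using atLeastLessThanSuc[of 11 "11 + x"] by auto
qed simp

section \<open>Correctness of the program on codes of instances\<close>

locale list_partition_program = list_partition n k l adj lst A S
  for n k l :: nat and adj lst A S :: "nat \<Rightarrow> nat \<Rightarrow> bool" +
  fixes inp :: "nat \<Rightarrow> nat"
  assumes adj_inp: "u < n \<Longrightarrow> v < n \<Longrightarrow> adj u v \<longleftrightarrow> inp (n + 1 + (u * n + v)) > 0"
    and lst_inp: "u < n \<Longrightarrow> x < k \<Longrightarrow> lst u x \<longleftrightarrow> inp (n + 1 + (n * n + (u * k + x))) > 0"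
begin

definition input_kept :: "(nat \<Rightarrow> nat) \<Rightarrow> bool" where
  "input_kept m \<longleftrightarrow> (\<forall>i<l. m i = inp i)"

text \<open>Vertices range below \<open>l\<close>, not \<open>n\<close>, because the loops do;
  initialisation clears the surplus entries.\<close>

definition table_of :: "(nat \<Rightarrow> nat) \<Rightarrow> table" where
  "table_of m = {q \<in> {..<l} \<times> {..<k} \<times> {..<l} \<times> {..<k}. m (addr k l q) > 0}"

lemma n_less: "n < l"
  by (simp add: l_eq)

lemma table_of_upd:
  assumes "u < l" "v < l" "x < k" "y < k"
  shows "table_of (m(addr k l (u, x, v, y) := b)) =
    (if b > 0 then insert (u, x, v, y) (table_of m) else table_of m - {(u, x, v, y)})"
  using assms addr_inject by (auto simp: table_of_def split: if_splits)

lemma input_kept_upd: "input_kept m \<Longrightarrow> input_kept (m(addr k l q := b))"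
  by (auto simp: input_kept_def addr_def split: prod.splits)

text \<open>\<open>R\<close> describes the effect of overwriting the given table entries one by one.\<close>

lemma run_table:
  fixes R :: "table \<Rightarrow> table \<Rightarrow> table \<Rightarrow> bool"
  assumes empty: "\<And>T. R {} T T"
    and trans: "\<And>Q Q' T T' T''. R Q T T' \<Longrightarrow> R Q' T' T'' \<Longrightarrow> R (Q \<union> Q') T T''"
    and single: "\<And>e' m u v x y.
      \<lbrakk>e' 4 = u; e' 5 = v; \<And>i. i \<notin> {4, 5} \<Longrightarrow> e' i = e i; input_kept m; u < l; v < l; x < k; y < k\<rbrakk> \<Longrightarrow>
      R {(u, x, v, y)} (table_of m) (if holds l (val x y) e' m
        then insert (u, x, v, y) (table_of m) else table_of m - {(u, x, v, y)})"
    and m: "input_kept m"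
    and run: "run l (table_com k val) (e, m) = (e', m')"
  shows "input_kept m' \<and> R ({..<l} \<times> {..<k} \<times> {..<l} \<times> {..<k}) (table_of m) (table_of m')"
proof -
  define body where "body ps = seqs (map (\<lambda>(x, y). St (addr_tm k (V 4) x (V 5) y) (val x y)) ps)" for ps
  \<comment> \<open>\<open>R\<close> is established for growing sets of entries: all colours at
    fixed \<open>u\<close> and \<open>v\<close>, then all \<open>v\<close>, then all
    \<open>u\<close>.\<close>
  have body: "fst (run l (body ps) (e1, m1)) = e1 \<and> input_kept (snd (run l (body ps) (e1, m1))) \<and>
      R ((\<lambda>(x, y). (u, x, v, y)) ` set ps) (table_of m1) (table_of (snd (run l (body ps) (e1, m1))))"
    if "set ps \<subseteq> {..<k} \<times> {..<k}" "input_kept m1" and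
      e1: "e1 4 = u" "e1 5 = v" "\<And>i. i \<notin> {4, 5} \<Longrightarrow> e1 i = e i" "u < l" "v < l"
    for ps e1 m1 u v
    using that(1,2)
  proof (induction ps arbitrary: m1)
    case Nil
    then show ?case
      by (simp add: body_def empty)
  next
    case (Cons p ps)
    obtain x y where p: "p = (x, y)" "x < k" "y < k"
      using Cons.prems(1) by (cases p) auto
    let ?m = "m1(addr k l (u, x, v, y) := eval l (val x y) e1 m1)"
    have r: "run l (body (p # ps)) (e1, m1) = run l (body ps) (e1, ?m)"
      by (simp add: body_def p e1(1,2))
    have "R {(u, x, v, y)} (table_of m1) (table_of ?m)"
      unfolding table_of_upd[OF e1(4,5) p(2,3)] by (rule single) (use e1 p Cons.prems in auto)
    moreover have IH: "fst (run l (body ps) (e1, ?m)) = e1 \<and>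
        input_kept (snd (run l (body ps) (e1, ?m))) \<and>
        R ((\<lambda>(x, y). (u, x, v, y)) ` set ps) (table_of ?m) (table_of (snd (run l (body ps) (e1, ?m))))"
    proof (rule Cons.IH)
      show "input_kept ?m"
        using Cons.prems(2) by (rule input_kept_upd)
    qed (use Cons.prems(1) in simp)
    ultimately have "R ({(u, x, v, y)} \<union> (\<lambda>(x, y). (u, x, v, y)) ` set ps) (table_of m1)
        (table_of (snd (run l (body ps) (e1, ?m))))"
      using trans by blast
    with IH show ?case
      unfolding r by (simp only: p set_simps image_insert prod.case insert_is_Un[symmetric])
  qed
  let ?ps = "List.product [0..<k] [0..<k]"
  have row: "(\<forall>i. i \<notin> {4, 5} \<longrightarrow> fst (run l (For 5 (body ?ps)) (e1, m1)) i = e i) \<and>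
      input_kept (snd (run l (For 5 (body ?ps)) (e1, m1))) \<and>
      R ({u} \<times> {..<k} \<times> {..<l} \<times> {..<k}) (table_of m1) (table_of (snd (run l (For 5 (body ?ps)) (e1, m1))))"
    if "input_kept m1" "e1 4 = u" "\<And>i. i \<notin> {4, 5} \<Longrightarrow> e1 i = e i" "u < l" for e1 m1 u
  proof -
    define Inv where "Inv j s \<longleftrightarrow> fst s 4 = u \<and> (\<forall>i. i \<notin> {4, 5} \<longrightarrow> fst s i = e i) \<and>
      input_kept (snd s) \<and> R ({u} \<times> {..<k} \<times> {..<j} \<times> {..<k}) (table_of m1) (table_of (snd s))"
      for j and s :: state
    have "Inv l (run l (For 5 (body ?ps)) (e1, m1))"
    proof (rule run_For_induct[where P = Inv])
      show "Inv 0 (e1, m1)"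
        using that empty by (auto simp: Inv_def)
    next
      fix j e2 m2
      assume j: "j < l" and IH: "Inv j (e2, m2)"
      let ?s = "run l (body ?ps) (e2(5 := j), m2)"
      have b: "fst ?s = e2(5 := j) \<and> input_kept (snd ?s) \<and>
          R ((\<lambda>(x, y). (u, x, j, y)) ` set ?ps) (table_of m2) (table_of (snd ?s))"
        by (rule body) (use IH j that(4) in \<open>auto simp: Inv_def\<close>)
      have "R ({u} \<times> {..<k} \<times> {..<j} \<times> {..<k}) (table_of m1) (table_of m2)"
        using IH by (simp add: Inv_def)
      from trans[OF this] b
      have "R ({u} \<times> {..<k} \<times> {..<j} \<times> {..<k} \<union> (\<lambda>(x, y). (u, x, j, y)) ` set ?ps)
          (table_of m1) (table_of (snd ?s))"
        by blast
      moreover have "{u} \<times> {..<k} \<times> {..<j} \<times> {..<k} \<union> (\<lambda>(x, y). (u, x, j, y)) ` set ?ps =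
          {u} \<times> {..<k} \<times> {..<Suc j} \<times> {..<k}"
        by (auto simp: less_Suc_eq image_iff)
      ultimately show "Inv (Suc j) ?s"
        using b IH by (auto simp: Inv_def)
    qed
    then show ?thesis
      by (simp add: Inv_def)
  qed
  define Inv where "Inv j s \<longleftrightarrow> (\<forall>i. i \<notin> {4, 5} \<longrightarrow> fst s i = e i) \<and>
    input_kept (snd s) \<and> R ({..<j} \<times> {..<k} \<times> {..<l} \<times> {..<k}) (table_of m) (table_of (snd s))"
    for j and s :: state
  have "Inv l (run l (For 4 (For 5 (body ?ps))) (e, m))"
  proof (rule run_For_induct[where P = Inv])
    show "Inv 0 (e, m)"
      using m empty by (auto simp: Inv_def)
  next
    fix j e2 m2
    assume j: "j < l" and IH: "Inv j (e2, m2)"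
    let ?s = "run l (For 5 (body ?ps)) (e2(4 := j), m2)"
    have b: "(\<forall>i. i \<notin> {4, 5} \<longrightarrow> fst ?s i = e i) \<and> input_kept (snd ?s) \<and>
        R ({j} \<times> {..<k} \<times> {..<l} \<times> {..<k}) (table_of m2) (table_of (snd ?s))"
      by (rule row) (use IH j in \<open>auto simp: Inv_def\<close>)
    have "R ({..<j} \<times> {..<k} \<times> {..<l} \<times> {..<k}) (table_of m) (table_of m2)"
      using IH by (simp add: Inv_def)
    from trans[OF this] b
    have "R ({..<j} \<times> {..<k} \<times> {..<l} \<times> {..<k} \<union> {j} \<times> {..<k} \<times> {..<l} \<times> {..<k})
        (table_of m) (table_of (snd ?s))"
      by blast
    moreover have "{..<j} \<times> {..<k} \<times> {..<l} \<times> {..<k} \<union> {j} \<times> {..<k} \<times> {..<l} \<times> {..<k} =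
        {..<Suc j} \<times> {..<k} \<times> {..<l} \<times> {..<k}"
      by (auto simp: less_Suc_eq)
    ultimately show "Inv (Suc j) ?s"
      using b by (simp add: Inv_def)
  qed
  then show ?thesis
    using run by (simp add: table_com_def body_def Inv_def)
qed

lemma eval_adj_tm:
  assumes "input_kept m" "e 1 = n" "e i = u" "e j = v" "u < n" "v < n" "i \<noteq> 9" "j \<noteq> 9"
  shows "holds l (adj_tm (V i) (V j)) e m \<longleftrightarrow> adj u v"
proof -
  have t: "eval l (tmul (V i) (V 1)) e m = u * n"
    by (rule eval_tmul) (use assms n_less in auto)
  \<comment> \<open>The cell read must lie below \<open>l\<close>, in the part of memory that table
    writes leave intact.\<close>
  have "Suc u * n \<le> n * n"
    using assms(5) by (intro mult_le_mono1) simp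
  then have "n + 1 + (u * n + v) < l"
    using assms(6) by (simp add: l_eq)
  then show ?thesis
    using assms adj_inp[of u v] by (simp add: adj_tm_def t input_kept_def del: One_nat_def)
qed

lemma eval_lst_tm:
  assumes "input_kept m" "e 1 = n" "e i = u" "u < n" "x < k" "i \<noteq> 9"
  shows "holds l (lst_tm k (V i) x) e m \<longleftrightarrow> lst u x"
proof -
  have t: "eval l (tmul (V i) (C k)) e m = u * k"
    by (rule eval_tmul) (use assms n_less in auto)
  have t': "eval l (tmul (V 1) (V 1)) e m = n * n"
    by (rule eval_tmul) (use assms n_less in auto)
  have "Suc u * k \<le> n * k"
    using assms(4) by (intro mult_le_mono1) simp
  then have "n + 1 + (n * n + (u * k + x)) < l"
    using assms(5) by (simp add: l_eq)
  then show ?thesis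
    using assms lst_inp[of u x] by (simp add: lst_tm_def t t' input_kept_def del: One_nat_def)
qed

lemma eval_compat_tm:
  assumes "input_kept m" "e 1 = n" "e i < n" "e j < n" "i \<noteq> 9" "j \<noteq> 9"
  shows "holds l (compat_tm A S (V i) x (V j) y) e m \<longleftrightarrow> compat (e i) x (e j) y"
  using eval_adj_tm[of m e i "e i" j "e j", OF assms(1,2) refl refl assms(3-6)] by (simp add: compat_tm_def compat_def)

lemma eval_possible_tm:
  assumes "input_kept m" "e 1 = n" "e i < n" "x < k" "i \<noteq> 9"
  shows "holds l (possible_tm k A S (V i) x) e m \<longleftrightarrow> possible (\<lambda>x. e (11 + x)) (e i) x"
proof -
  have "holds l (tif (tless (V (11 + y)) (V 1))
      (tif (teq (V i) (V (11 + y))) (tbool (x = y))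
        (tand (compat_tm A S (V i) x (V (11 + y)) y) (compat_tm A S (V (11 + y)) y (V i) x))) (tbool True)) e m \<longleftrightarrow>
      (e (11 + y) < n \<longrightarrow> (if e i = e (11 + y) then x = y
        else compat (e i) x (e (11 + y)) y \<and> compat (e (11 + y)) y (e i) x))" for y
    using eval_compat_tm[of m e i "11 + y" x y] eval_compat_tm[of m e "11 + y" i y x] assms
    by auto
  with eval_lst_tm[of m e i "e i" x, OF assms(1,2) refl assms(3-5)] assms(2) show ?thesis
    by (auto simp: possible_tm_def possible_def)
qed

lemma eval_init_tm:
  assumes "input_kept m" "e 1 = n" "x < k" "y < k"
  shows "holds l (init_tm k A S x y) e m \<longleftrightarrow> (e 4, x, e 5, y) \<in> T0 (\<lambda>x. e (11 + x))"
  using assms eval_possible_tm[of m e 4 x] eval_possible_tm[of m e 5 y]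
    eval_compat_tm[of m e 4 5 x y] eval_compat_tm[of m e 5 4 y x]
  by (auto simp: init_tm_def T0_def)

lemma eval_upd_tm:
  assumes "e 1 = n" "e 4 < l" "e 5 < l" "x < k" "y < k"
  shows "holds l (upd_tm k x y) e m \<longleftrightarrow> (e 4, x, e 5, y) \<in> table_of m \<and> \<not> unsupported (table_of m) (e 4, x, e 5, y)"
proof -
  have "holds l (upd_tm k x y) e m \<longleftrightarrow> m (addr k l (e 4, x, e 5, y)) > 0 \<and>
      (\<forall>w<l. w < n \<longrightarrow> (\<exists>z<k. m (addr k l (e 4, x, w, z)) > 0 \<and> m (addr k l (e 5, y, w, z)) > 0))"
    using assms(1) by (simp add: upd_tm_def Bex_def)
  then show ?thesis
    using assms n_less by (auto simp: table_of_def unsupported_def)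
qed

lemma eval_check_tm:
  assumes "e 1 = n"
  shows "holds l (check_tm k) e m \<longleftrightarrow> (\<forall>u<n. \<exists>x<k. (u, x, u, x) \<in> table_of m)"
proof -
  have "holds l (check_tm k) e m \<longleftrightarrow> (\<forall>u<l. u < n \<longrightarrow> (\<exists>x<k. m (addr k l (u, x, u, x)) > 0))"
    using assms by (simp add: check_tm_def Bex_def)
  then show ?thesis
    using n_less by (auto simp: table_of_def)
qed

lemma run_inner:
  assumes "input_kept m" "e 1 = n"
  shows "input_kept (snd (run l (inner_com k A S) (e, m)))"
    and "fst (run l (inner_com k A S) (e, m)) 3 > 0 \<longleftrightarrow> e 3 > 0 \<or> feasible (\<lambda>x. e (11 + x))"
proof -
  define g where "g x = e (11 + x)" for x
  \<comment> \<open>\<open>r\<close> counts the completed sweeps of the table for the guess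
    \<open>g\<close>.\<close>
  define K where "K r s \<longleftrightarrow> fst s 1 = n \<and> fst s 3 = e 3 \<and> (\<forall>x. fst s (11 + x) = g x) \<and>
    input_kept (snd s) \<and> progress g r (table_of (snd s))" for r and s :: state
  let ?full = "{..<l} \<times> {..<k} \<times> {..<l} \<times> {..<k}"
  have T0_full: "T0 g \<subseteq> ?full"
    using T0_subset[of g] n_less by fastforce
  obtain e1 m1 where s1: "run l (table_com k (init_tm k A S)) (e, m) = (e1, m1)"
    by fastforce
  have e1: "e1 i = e i" if "i \<notin> {4, 5}" for i
    using run_not_assigned[of i "table_com k (init_tm k A S)" l "(e, m)"] that by (simp add: s1)
  \<comment> \<open>Here \<open>R Q T T'\<close> says that entries in \<open>Q\<close> are decided
    by \<open>T0 g\<close> and all others are as in \<open>T\<close>. With \<open>Q\<close> the full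
    range, nothing of the previous memory contents remains.\<close>
  have m1: "input_kept m1 \<and> (\<forall>q. q \<in> table_of m1 \<longleftrightarrow> (if q \<in> ?full then q \<in> T0 g else q \<in> table_of m))"
  proof (rule run_table[OF _ _ _ assms(1) s1])
    show "\<forall>q. (q \<in> (if holds l (init_tm k A S x y) e' m' then insert (u, x, v, y) (table_of m')
        else table_of m' - {(u, x, v, y)})) \<longleftrightarrow> (if q \<in> {(u, x, v, y)} then q \<in> T0 g else q \<in> table_of m')"
      if "e' 4 = u" "e' 5 = v" "\<And>i. i \<notin> {4, 5} \<Longrightarrow> e' i = e i" "input_kept m'" "x < k" "y < k"
      for e' m' u v x y
    proof -
      have "e' 1 = n" "(\<lambda>x. e' (11 + x)) = g"
        using that(3) assms(2) by (auto simp: g_def)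
      with eval_init_tm[of m' e' x y] that show ?thesis
        by auto
    qed
  qed auto
  have "table_of m1 = T0 g"
  proof -
    have "X = Y" if "\<forall>q. q \<in> X \<longleftrightarrow> (if q \<in> F then q \<in> Y else q \<in> Z)" "X \<subseteq> F" "Y \<subseteq> F" for X Y Z F :: table
      using that by (meson subset_antisym subset_iff)
    moreover have "table_of m1 \<subseteq> ?full"
      by (auto simp: table_of_def)
    ultimately show ?thesis
      using m1 T0_full by blast
  qed
  then have "K 0 (e1, m1)"
    using m1 e1 assms(2) progress_start by (simp add: K_def g_def)
  have round: "K (Suc r) (run l (table_com k (upd_tm k)) (e2, m2))" if K: "K r (e2, m2)" for r e2 m2
  proof -
    obtain e3 m3 where s3: "run l (table_com k (upd_tm k)) (e2, m2) = (e3, m3)"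
      by fastforce
    have e3: "e3 i = e2 i" if "i \<notin> {4, 5}" for i
      using run_not_assigned[of i "table_com k (upd_tm k)" l "(e2, m2)"] that by (simp add: s3)
    have m2: "input_kept m2"
      using K by (simp add: K_def)
    have "input_kept m3 \<and> sweep ?full (table_of m2) (table_of m3)"
    proof (rule run_table[OF sweep_empty sweep_trans _ m2 s3])
      show "sweep {(u, x, v, y)} (table_of m') (if holds l (upd_tm k x y) e' m'
          then insert (u, x, v, y) (table_of m') else table_of m' - {(u, x, v, y)})"
        if "e' 4 = u" "e' 5 = v" "\<And>i. i \<notin> {4, 5} \<Longrightarrow> e' i = e2 i" "u < l" "v < l" "x < k" "y < k"
        for e' m' u v x y
      proof -
        have "e' 1 = n"
          using that(3) K by (simp add: K_def)
        with eval_upd_tm[of e' x y m'] sweep_single[of "(u, x, v, y)" "table_of m'"] that show ?thesis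
          by simp
      qed
    qed
    with progress_step[OF _ _ T0_full] K e3 show ?thesis
      unfolding s3 by (auto simp: K_def)
  qed
  \<comment> \<open>One inner loop adds \<open>l\<close> sweeps, so the outer loop reaches the
    \<open>l * l\<close> required by \<open>progress_end\<close>.\<close>
  have rounds: "K (r + l) (run l (For 7 (table_com k (upd_tm k))) (e2, m2))" if K: "K r (e2, m2)" for r e2 m2
  proof -
    have "(\<lambda>j. K (r + j)) l (run l (For 7 (table_com k (upd_tm k))) (e2, m2))"
    proof (rule run_For_induct[where P = "\<lambda>j. K (r + j)"])
      show "K (r + Suc j) (run l (table_com k (upd_tm k)) (e4(7 := j), m4))" if "K (r + j) (e4, m4)" for j e4 m4
        using round[of "r + j" "e4(7 := j)" m4] that by (simp add: K_def)
    qed (use K in simp)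
    then show ?thesis
      by simp
  qed
  obtain e2 m2 where s2: "run l (For 6 (For 7 (table_com k (upd_tm k)))) (e1, m1) = (e2, m2)"
    by fastforce
  have "(\<lambda>j. K (j * l)) l (run l (For 6 (For 7 (table_com k (upd_tm k)))) (e1, m1))"
  proof (rule run_For_induct[where P = "\<lambda>j. K (j * l)"])
    show "K (Suc j * l) (run l (For 7 (table_com k (upd_tm k))) (e4(6 := j), m4))" if "K (j * l) (e4, m4)" for j e4 m4
      using rounds[of "j * l" "e4(6 := j)" m4] that by (simp add: K_def add.commute)
  qed (use \<open>K 0 (e1, m1)\<close> in simp)
  then have K2: "K (l * l) (e2, m2)"
    by (simp only: s2)
  have r: "run l (inner_com k A S) (e, m) = (e2(3 := e2 3 + eval l (check_tm k) e2 m2), m2)"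
    using s1 s2 by (simp add: inner_com_def del: run.simps(5))
  show "input_kept (snd (run l (inner_com k A S) (e, m)))"
    using K2 by (simp add: r K_def)
  have "holds l (check_tm k) e2 m2 \<longleftrightarrow> feasible g"
    using eval_check_tm[of e2 m2] progress_end[of g "table_of m2"] K2 by (simp add: K_def)
  then show "fst (run l (inner_com k A S) (e, m)) 3 > 0 \<longleftrightarrow> e 3 > 0 \<or> feasible (\<lambda>x. e (11 + x))"
    using K2 by (simp add: r K_def g_def[abs_def])
qed

text \<open>The induction is on the number of guessed colours: the guesses from \<open>x\<close> on
  are fixed by the surrounding loops, hence read off the environment, and those below
  \<open>x\<close> range freely.\<close>

lemma run_guesses:
  assumes "input_kept m" "e 1 = n"
  shows "input_kept (snd (run l (guesses (inner_com k A S) x) (e, m))) \<and>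
    (fst (run l (guesses (inner_com k A S) x) (e, m)) 3 > 0 \<longleftrightarrow> e 3 > 0 \<or>
      (\<exists>g. (\<forall>i<x. g i < l) \<and> (\<forall>i\<ge>x. g i = e (11 + i)) \<and> feasible g))"
  using assms
proof (induction x arbitrary: e m)
  case 0
  have "(\<forall>i. g i = e (11 + i)) \<longleftrightarrow> g = (\<lambda>x. e (11 + x))" for g
    by auto
  with run_inner[of m e] 0 show ?case
    by simp
next
  case (Suc x)
  let ?c = "guesses (inner_com k A S) x"
  have asg: "assigned ?c = {3..7} \<union> {11..<11 + x}"
    unfolding assigned_guesses by (auto simp: inner_com_def)
  \<comment> \<open>After \<open>j\<close> rounds exactly the guesses with \<open>g x < j\<close>
    have been tried.\<close>
  define Inv where "Inv j s \<longleftrightarrow> fst s 1 = n \<and> (\<forall>i>x. fst s (11 + i) = e (11 + i)) \<and> input_kept (snd s) \<and>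
    (fst s 3 > 0 \<longleftrightarrow> e 3 > 0 \<or>
      (\<exists>g. (\<forall>i<x. g i < l) \<and> g x < j \<and> (\<forall>i>x. g i = e (11 + i)) \<and> feasible g))"
    for j and s :: state
  have "Inv l (run l (For (11 + x) ?c) (e, m))"
  proof (rule run_For_induct[where P = Inv])
    show "Inv 0 (e, m)"
      using Suc.prems by (simp add: Inv_def)
  next
    fix j e2 m2
    assume j: "j < l" and IH: "Inv j (e2, m2)"
    let ?e = "e2(11 + x := j)"
    let ?s = "run l ?c (?e, m2)"
    have keep: "fst ?s i = ?e i" if "i \<notin> {3..7} \<union> {11..<11 + x}" for i
      using run_not_assigned[of i ?c l "(?e, m2)"] that asg by simp
    have ge: "(\<forall>i\<ge>x. g i = ?e (11 + i)) \<longleftrightarrow> g x = j \<and> (\<forall>i>x. g i = e (11 + i))" for g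
      using IH by (auto simp: Inv_def le_less)
    have s: "input_kept (snd ?s)" "fst ?s 3 > 0 \<longleftrightarrow> ?e 3 > 0 \<or>
        (\<exists>g. (\<forall>i<x. g i < l) \<and> (g x = j \<and> (\<forall>i>x. g i = e (11 + i))) \<and> feasible g)"
    proof -
      have "input_kept m2" "?e 1 = n"
        using IH by (simp_all add: Inv_def)
      note Suc.IH[of m2 ?e, OF this, unfolded ge]
      then show "input_kept (snd ?s)" "fst ?s 3 > 0 \<longleftrightarrow> ?e 3 > 0 \<or>
          (\<exists>g. (\<forall>i<x. g i < l) \<and> (g x = j \<and> (\<forall>i>x. g i = e (11 + i))) \<and> feasible g)"
        by blast+
    qed
    have "fst ?s 1 = n" "\<forall>i>x. fst ?s (11 + i) = e (11 + i)"
      using keep IH by (auto simp: Inv_def)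
    moreover have "fst ?s 3 > 0 \<longleftrightarrow> e 3 > 0 \<or>
        (\<exists>g. (\<forall>i<x. g i < l) \<and> g x < Suc j \<and> (\<forall>i>x. g i = e (11 + i)) \<and> feasible g)"
    proof -
      have "fst ?s 3 > 0 \<longleftrightarrow> (e 3 > 0 \<or>
          (\<exists>g. (\<forall>i<x. g i < l) \<and> g x < j \<and> (\<forall>i>x. g i = e (11 + i)) \<and> feasible g)) \<or>
          (\<exists>g. (\<forall>i<x. g i < l) \<and> (g x = j \<and> (\<forall>i>x. g i = e (11 + i))) \<and> feasible g)"
        using s(2) IH by (simp add: Inv_def)
      then show ?thesis
        unfolding less_Suc_eq by blast
    qed
    ultimately show "Inv (Suc j) ?s"
      using s(1) by (simp add: Inv_def)
  qed
  moreover have "(\<forall>i<Suc x. g i < l) \<and> (\<forall>i\<ge>Suc x. g i = e (11 + i)) \<longleftrightarrow>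
      (\<forall>i<x. g i < l) \<and> g x < l \<and> (\<forall>i>x. g i = e (11 + i))" for g
    by (auto simp: less_Suc_eq Suc_le_eq)
  ultimately show ?case
    by (simp add: Inv_def del: run.simps(5) flip: conj_assoc)
qed

end

section \<open>Recognition of codes\<close>

lemma holds_wf_tm:
  assumes "j < l"
  shows "holds l (wf_tm k (V 10)) (e(10 := j)) m \<longleftrightarrow>
    l = j + 1 + (j * j + j * k) \<and> m j = 0 \<and> (\<forall>i<j. m i > 0)"
proof -
  have t: "eval l (tmul (V 10) (V 10)) (e(10 := j)) m = j * j"
    by (rule eval_tmul) (use assms in auto)
  have t': "eval l (tmul (V 10) (C k)) (e(10 := j)) m = j * k"
    by (rule eval_tmul) (use assms in auto)
  show ?thesis
    using assms by (auto simp: wf_tm_def t t')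
qed

lemma run_main:
  obtains e' where "fst (run l (main_com k A S) (e, m)) 0 =
      (if e' 2 > 0 \<and> e' 3 > 0 then 1 else 0)"
    and "e' = fst (run l (guesses (inner_com k A S) k)
      (e(1 := eval l (vertices_tm k) e m,
        2 := eval l (valid_tm k) (e(1 := eval l (vertices_tm k) e m)) m), m))"
    and "e' 2 = eval l (valid_tm k) (e(1 := eval l (vertices_tm k) e m)) m"
proof -
  let ?n = "eval l (vertices_tm k) e m"
  let ?wf = "eval l (valid_tm k) (e(1 := ?n)) m"
  obtain e' m' where r: "run l (guesses (inner_com k A S) k) (e(1 := ?n, 2 := ?wf), m) = (e', m')"
    by fastforce
  have "e' 2 = ?wf"
  proof -
    have "2 \<notin> assigned (guesses (inner_com k A S) k)"
      by (simp add: assigned_guesses inner_com_def)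
    from run_not_assigned[OF this, of l "(e(1 := ?n, 2 := ?wf), m)"] show ?thesis
      unfolding r by simp
  qed
  moreover have "run l (main_com k A S) (e, m) =
      (e'(0 := eval l (Cond (V 2) (Cond (V 3) (C 1) (C 0)) (C 0)) e' m'), m')"
    using r by (simp add: main_com_def del: eval.simps One_nat_def)
  ultimately show ?thesis
    by (intro that[of e']) (simp_all add: r del: One_nat_def)
qed

text \<open>On a malformed word the program still runs through all loops on meaningless data;
  variable 2 being 0 is what prevents acceptance.\<close>

lemma run_main_ill_formed:
  assumes "\<not> (\<exists>j<l. l = j + 1 + (j * j + j * k) \<and> m j = 0 \<and> (\<forall>i<j. m i > 0))"
  shows "fst (run l (main_com k A S) (e, m)) 0 = 0"
proof -
  have "eval l (wf_tm k (V 10)) (e'(10 := j)) m = 0" if "j < l" for e' j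
    using holds_wf_tm[OF that] assms that by (metis gr0I)
  then have "eval l (valid_tm k) e' m = 0" for e'
    by (simp add: valid_tm_def)
  with run_main[of l k A S e m] show ?thesis
    by (metis less_irrefl)
qed

lemma (in list_partition_program) run_main_well_formed:
  assumes "inp n = 0" "\<forall>i<n. inp i > 0" "e 3 = 0"
  shows "fst (run l (main_com k A S) (e, inp)) 0 = 1 \<longleftrightarrow> (\<exists>f. solution f)"
proof -
  \<comment> \<open>Any \<open>j\<close> that passes is the position of the first zero, and so is
    \<open>n\<close>.\<close>
  have wf: "holds l (wf_tm k (V 10)) (e'(10 := j)) inp \<longleftrightarrow> j = n" if "j < l" for e' j
    using holds_wf_tm[OF that, of k e' inp] assms l_eq
    by (metis add.assoc linorder_neqE_nat less_irrefl)
  have "eval l (vertices_tm k) e inp = (\<Sum>j<l. if j = n then j else 0)"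
    unfolding vertices_tm_def eval.simps by (rule sum.cong[OF refl]) (use wf in auto)
  then have n: "eval l (vertices_tm k) e inp = n"
    using n_less by simp
  have wf_pos: "eval l (valid_tm k) e' inp > 0" for e'
    using wf[OF n_less, of e'] n_less unfolding valid_tm_def eval.simps
    by (intro sum_pos2[of _ n]) auto
  obtain e' where e': "fst (run l (main_com k A S) (e, inp)) 0 = (if e' 2 > 0 \<and> e' 3 > 0 then 1 else 0)"
      "e' = fst (run l (guesses (inner_com k A S) k)
        (e(1 := n, 2 := eval l (valid_tm k) (e(1 := n)) inp), inp))"
      "e' 2 = eval l (valid_tm k) (e(1 := n)) inp"
    using run_main[of l k A S e inp] unfolding n by metis
  have "e' 3 > 0 \<longleftrightarrow> (\<exists>g. (\<forall>i<k. g i < l) \<and> (\<forall>i\<ge>k. g i = e (11 + i)) \<and> feasible g)"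
    using run_guesses[of inp "e(1 := n, 2 := eval l (valid_tm k) (e(1 := n)) inp)" k] assms(3)
    unfolding e'(2) by (simp add: input_kept_def del: eval.simps)
  also have "\<dots> \<longleftrightarrow> (\<exists>f. solution f)"
    using feasible_imp_solution solution_imp_feasible[of _ "\<lambda>i. e (11 + i)"] by blast
  finally show ?thesis
    using e'(1,3) wf_pos by simp
qed

section \<open>Decoding instances\<close>

lemma length_concat_uniform [simp]: "length (concat (map (\<lambda>u. map (h u) [0..<c]) [0..<r])) = r * c"
  by (induction r) auto

lemma nth_concat_uniform:
  assumes "u < r" "v < c"
  shows "concat (map (\<lambda>u. map (h u) [0..<c]) [0..<r]) ! (u * c + v) = h u v"
  using assms
proof (induction r)
  case (Suc r)
  show ?case
  proof (cases "u < r")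
    case True
    then have "Suc u * c \<le> r * c"
      by (intro mult_le_mono1) simp
    then have "u * c + v < r * c"
      using Suc.prems by simp
    with Suc True show ?thesis
      by (simp add: nth_append)
  next
    case False
    with Suc.prems have "u = r"
      by simp
    with Suc.prems show ?thesis
      by (simp add: nth_append)
  qed
qed simp

lemma concat_slices:
  assumes "length xs = r * c"
  shows "concat (map (\<lambda>u. map (\<lambda>v. xs ! (u * c + v)) [0..<c]) [0..<r]) = xs"
proof (rule nth_equalityI)
  fix i
  assume "i < length (concat (map (\<lambda>u. map (\<lambda>v. xs ! (u * c + v)) [0..<c]) [0..<r]))"
  then have i: "i < r * c"
    by simp
  then have "c > 0"
    by (cases c) auto
  with i have "i div c < r" "i mod c < c"
    by (auto simp: less_mult_imp_div_less)
  from nth_concat_uniform[OF this, of "\<lambda>u v. xs ! (u * c + v)"]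
  show "concat (map (\<lambda>u. map (\<lambda>v. xs ! (u * c + v)) [0..<c]) [0..<r]) ! i = xs ! i"
    by simp
qed (simp add: assms)

lemma encode_eq:
  "encode hs G L = replicate (card (pverts G)) True @ [False] @
    concat (map (\<lambda>u. map (\<lambda>v. (u, v) \<in> parcs G) [0..<card (pverts G)]) [0..<card (pverts G)]) @
    concat (map (\<lambda>u. map (\<lambda>x. hs ! x \<in> L u) [0..<length hs]) [0..<card (pverts G)])"
proof -
  have "map (\<lambda>x. x \<in> L u) hs = map (\<lambda>x. hs ! x \<in> L u) [0..<length hs]" for u
    by (rule nth_equalityI) auto
  then show ?thesis
    by (simp add: encode_def Let_def)
qed

lemma encode_nth:
  fixes hs :: "'a list"
  defines "k \<equiv> length hs"
  assumes "card (pverts G) = n" and w: "w = encode hs G L"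
  shows "length w = n + 1 + (n * n + n * k)"
    and "i < n \<Longrightarrow> w ! i" and "\<not> w ! n"
    and "u < n \<Longrightarrow> v < n \<Longrightarrow> w ! (n + 1 + (u * n + v)) \<longleftrightarrow> (u, v) \<in> parcs G"
    and "u < n \<Longrightarrow> x < k \<Longrightarrow> w ! (n + 1 + (n * n + (u * k + x))) \<longleftrightarrow> hs ! x \<in> L u"
proof -
  let ?M = "concat (map (\<lambda>u. map (\<lambda>v. (u, v) \<in> parcs G) [0..<n]) [0..<n])"
  let ?Ls = "concat (map (\<lambda>u. map (\<lambda>x. hs ! x \<in> L u) [0..<k]) [0..<n])"
  have w: "w = replicate n True @ False # ?M @ ?Ls"
    using assms by (simp add: encode_eq)
  show "length w = n + 1 + (n * n + n * k)" "i < n \<Longrightarrow> w ! i" "\<not> w ! n"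
    by (simp_all add: w nth_append)
  have nth: "w ! (n + 1 + i) = (?M @ ?Ls) ! i" for i
    by (simp add: w nth_append)
  show "w ! (n + 1 + (u * n + v)) \<longleftrightarrow> (u, v) \<in> parcs G" if "u < n" "v < n"
  proof -
    have "Suc u * n \<le> n * n"
      using that by (intro mult_le_mono1) simp
    then have "u * n + v < n * n"
      using that by simp
    then show ?thesis
      using nth_concat_uniform[OF that, of "\<lambda>u v. (u, v) \<in> parcs G"] unfolding nth
      by (simp add: nth_append)
  qed
  show "w ! (n + 1 + (n * n + (u * k + x))) \<longleftrightarrow> hs ! x \<in> L u" if "u < n" "x < k"
    using nth_concat_uniform[OF that, of "\<lambda>u x. hs ! x \<in> L u"] unfolding nth
    by (simp add: nth_append)
qed

text \<open>Every word of the right format is a code. As \<open>hs\<close> is distinct, membership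
  of \<open>hs ! x\<close> in a decoded list depends on the bit at \<open>x\<close> alone.\<close>

lemma decode:
  fixes hs :: "'a list"
  defines "k \<equiv> length hs"
  assumes w: "length w = n + 1 + (n * n + n * k)" "\<forall>i<n. w ! i" "\<not> w ! n" and hs: "distinct hs"
  shows "w = encode hs \<lparr>pverts = {..<n}, parcs = {(u, v). u < n \<and> v < n \<and> w ! (n + 1 + (u * n + v))}\<rparr>
    (\<lambda>u. {hs ! x | x. x < k \<and> w ! (n + 1 + (n * n + (u * k + x)))})"
proof -
  let ?M = "take (n * n) (drop (n + 1) w)" and ?Ls = "drop (n * n) (drop (n + 1) w)"
  have "take n w = replicate n True"
    by (rule nth_equalityI) (use w in auto)
  moreover have "w = take n w @ w ! n # drop (n + 1) w"
    using w(1) by (simp add: id_take_nth_drop)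
  moreover have "drop (n + 1) w = ?M @ ?Ls"
    by (rule append_take_drop_id[symmetric])
  ultimately have split: "w = replicate n True @ False # ?M @ ?Ls"
    using w(3) by metis
  have M: "?M = concat (map (\<lambda>u. map (\<lambda>v. ?M ! (u * n + v)) [0..<n]) [0..<n])"
    by (rule concat_slices[symmetric]) (use w(1) in simp)
  have Ls: "?Ls = concat (map (\<lambda>u. map (\<lambda>x. ?Ls ! (u * k + x)) [0..<k]) [0..<n])"
    by (rule concat_slices[symmetric]) (use w(1) in simp)
  have M_nth: "?M ! (u * n + v) = w ! (n + 1 + (u * n + v))" if "u < n" "v < n" for u v
  proof -
    have "Suc u * n \<le> n * n"
      using that by (intro mult_le_mono1) simp
    then have "u * n + v < n * n"
      using that by simp
    then show ?thesis
      using w(1) by simp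
  qed
  have Ls_nth: "?Ls ! (u * k + x) = w ! (n + 1 + (n * n + (u * k + x)))" for u x
    using w(1) by (simp add: add_ac)
  have inj: "hs ! x = hs ! y \<longleftrightarrow> x = y" if "x < k" "y < k" for x y
    using hs that by (simp add: k_def nth_eq_iff_index_eq)
  define P where "P u v \<longleftrightarrow> u < n \<and> v < n \<and> w ! (n + 1 + (u * n + v))" for u v
  define L where "L u = {hs ! x | x. x < k \<and> w ! (n + 1 + (n * n + (u * k + x)))}" for u
  have "hs ! x \<in> L u \<longleftrightarrow> ?Ls ! (u * k + x)" if "x < k" for u x
    using inj that unfolding L_def Ls_nth by blast
  then have Ls': "?Ls = concat (map (\<lambda>u. map (\<lambda>x. hs ! x \<in> L u) [0..<k]) [0..<n])"
    by (subst Ls, intro arg_cong[of _ _ concat] map_cong refl) auto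
  have M_P: "?M ! (u * n + v) = P u v" if "u < n" "v < n" for u v
    by (simp only: P_def M_nth[OF that] that simp_thms)
  have M': "?M = concat (map (\<lambda>u. map (\<lambda>v. P u v) [0..<n]) [0..<n])"
    by (subst M, intro arg_cong[of _ _ concat] map_cong refl M_P) simp_all
  have "encode hs \<lparr>pverts = {..<n}, parcs = {(u, v). P u v}\<rparr> L =
      replicate n True @ False # ?M @ ?Ls"
    unfolding M' Ls' by (simp add: encode_eq k_def)
  with split have "w = encode hs \<lparr>pverts = {..<n}, parcs = {(u, v). P u v}\<rparr> L"
    by simp
  then show ?thesis
    unfolding P_def L_def .
qed

theorem theorem3:
  fixes H :: "'a trigraph"
  assumes "trigraph H"
    and "\<forall>x\<in>tverts H. (x, x) \<in> strong H"
    and "triangle_free (symmetric_graph H)"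
  shows "L_HOM_polynomial_time_solvable H"
  unfolding L_HOM_polynomial_time_solvable_def
proof (intro allI impI)
  fix hs :: "'a list"
  assume "distinct hs \<and> set hs = tverts H"
  then have hs: "distinct hs" "set hs = tverts H"
    by auto
  define k where "k = length hs"
  define A where "A x y \<longleftrightarrow> (hs ! x, hs ! y) \<in> weak H \<union> strong H" for x y
  define S where "S x y \<longleftrightarrow> (hs ! x, hs ! y) \<in> strong H" for x y
  have mem: "hs ! x \<in> tverts H" if "x < k" for x
    using that nth_mem[of x hs] unfolding hs(2) k_def by blast
  have inj: "hs ! x = hs ! y \<longleftrightarrow> x = y" if "x < k" "y < k" for x y
    using hs(1) that by (simp add: k_def nth_eq_iff_index_eq)
  show "polynomial_time (L_HOM H hs)"
  proof (rule polynomial_time_if_run)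
    fix w :: "bool list"
    let ?l = "length w"
    let ?m = "\<lambda>i. if i < ?l \<and> w ! i then 1 else 0 :: nat"
    let ?e = "(\<lambda>_. 0)(0 := ?l) :: nat \<Rightarrow> nat"
    show "fst (run ?l (main_com k A S) (?e, ?m)) 0 = 1 \<longleftrightarrow> w \<in> L_HOM H hs"
    proof (cases "\<exists>n<?l. ?l = n + 1 + (n * n + n * k) \<and> ?m n = 0 \<and> (\<forall>i<n. ?m i > 0)")
      case False
      have "w \<notin> L_HOM H hs"
      proof
        assume "w \<in> L_HOM H hs"
        then obtain G L where "w = encode hs G L"
          by (auto simp: L_HOM_def)
        from encode_nth[OF refl this] False show False
          unfolding k_def by auto
      qed
      with run_main_ill_formed[OF False] show ?thesis
        by simp
    next
      case True
      then obtain n where n: "n < ?l" "?l = n + 1 + (n * n + n * k)" "\<not> w ! n" "\<forall>i<n. w ! i"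
        by (auto split: if_splits)
      \<comment> \<open>The abstract instance is read off the word itself; that it agrees with any
        graph encoded by the word is shown afterwards.\<close>
      define adj where "adj u v \<longleftrightarrow> w ! (n + 1 + (u * n + v))" for u v
      define lst where "lst u x \<longleftrightarrow> w ! (n + 1 + (n * n + (u * k + x)))" for u x
      interpret list_partition_program n k ?l adj lst A S ?m
      proof
        show "S x x" if "x < k" for x
          using assms(2) mem[OF that] by (simp add: S_def)
        show False if "x < k" "y < k" "z < k" "x \<noteq> y" "y \<noteq> z" "x \<noteq> z"
          "A x y" "A y x" "A y z" "A z y" "A x z" "A z x" for x y z
        proof -
          have "(hs ! a, hs ! b) \<in> parcs (symmetric_graph H)" if "a < k" "b < k" "a \<noteq> b" "A a b" "A b a" for a b
            using that mem inj by (simp add: symmetric_graph_def A_def)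
          note edge = this
          have "(hs ! x, hs ! y) \<in> parcs (symmetric_graph H)" "(hs ! y, hs ! z) \<in> parcs (symmetric_graph H)"
              "(hs ! x, hs ! z) \<in> parcs (symmetric_graph H)"
            using that by (intro edge; simp)+
          moreover have "hs ! x \<noteq> hs ! y" "hs ! y \<noteq> hs ! z" "hs ! x \<noteq> hs ! z"
            using that inj by auto
          ultimately show False
            using assms(3) unfolding triangle_free_def by metis
        qed
        show "?l = n + 1 + n * n + n * k"
          using n(2) by simp
        show "adj u v \<longleftrightarrow> ?m (n + 1 + (u * n + v)) > 0" if "u < n" "v < n" for u v
        proof -
          have "Suc u * n \<le> n * n"
            using that by (intro mult_le_mono1) simp
          then show ?thesis
            using that n(2) by (simp add: adj_def)
        qed
        show "lst u x \<longleftrightarrow> ?m (n + 1 + (n * n + (u * k + x))) > 0" if "u < n" "x < k" for u x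
        proof -
          have "Suc u * k \<le> n * k"
            using that by (intro mult_le_mono1) simp
          then show ?thesis
            using that n(2) by (simp add: lst_def)
        qed
      qed
      have "(\<exists>f. solution f) \<longleftrightarrow> w \<in> L_HOM H hs"
      proof
        assume "\<exists>f. solution f"
        then obtain f where f: "solution f" ..
        let ?G = "\<lparr>pverts = {..<n}, parcs = {(u, v). u < n \<and> v < n \<and> w ! (n + 1 + (u * n + v))}\<rparr>"
        let ?L = "\<lambda>u. {hs ! x | x. x < k \<and> w ! (n + 1 + (n * n + (u * k + x)))}"
        have "w = encode hs ?G ?L"
          using decode[OF n(2)[unfolded k_def] n(4,3) hs(1)] by (simp add: k_def)
        moreover have "pair_fin_digraph ?G"
          by unfold_locales (auto intro: finite_subset[of _ "{..<n} \<times> {..<n}"])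
        moreover have "\<forall>u\<in>pverts ?G. ?L u \<subseteq> tverts H"
          using mem by auto
        moreover have "list_colouring ?G ?L H (\<lambda>u. hs ! f u)"
        proof -
          have "f u < k" "lst u (f u)" if "u < n" for u
            using f that by (auto simp: solution_def)
          moreover have "if adj u v then A (f u) (f v) else \<not> S (f u) (f v)"
            if "u < n" "v < n" "u \<noteq> v" for u v
            using f that by (simp add: solution_def compat_def)
          then have "adj u v \<Longrightarrow> A (f u) (f v)" "\<not> adj u v \<Longrightarrow> \<not> S (f u) (f v)"
            if "u < n" "v < n" "u \<noteq> v" for u v
            using that by (metis (full_types))+
          ultimately show ?thesis
            using mem by (auto simp: list_colouring_def trigraph_hom_def adj_def lst_def A_def S_def)
        qed
        ultimately show "w \<in> L_HOM H hs"
          unfolding L_HOM_def by fastforce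
      next
        assume "w \<in> L_HOM H hs"
        then obtain G L f where w: "w = encode hs G L" and G: "pverts G = {..<card (pverts G)}"
          and f: "list_colouring G L H f"
          by (auto simp: L_HOM_def)
        note enc = encode_nth[OF refl w]
        \<comment> \<open>Both numbers are the position of the first \<open>False\<close> in
          \<open>w\<close>.\<close>
        have card: "card (pverts G) = n"
          using enc(2,3) n(3,4) by (metis linorder_neqE_nat)
        have "\<exists>x<k. hs ! x = f u" if "u < n" for u
        proof -
          have "f u \<in> set hs"
            using f that G card hs(2) by (auto simp: list_colouring_def trigraph_hom_def)
          then show ?thesis
            by (simp add: in_set_conv_nth k_def)
        qed
        then obtain f' where f': "f' u < k" "hs ! f' u = f u" if "u < n" for u
          by metis
        have "lst u (f' u)" if "u < n" for u
          using enc(5)[of u "f' u"] f that f'[OF that] G card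
          by (auto simp: lst_def k_def list_colouring_def)
        moreover have "compat u (f' u) v (f' v)" if "u < n" "v < n" "u \<noteq> v" for u v
        proof -
          have "adj u v \<longleftrightarrow> (u, v) \<in> parcs G"
            using enc(4)[of u v] that card by (simp add: adj_def)
          moreover have "u \<in> pverts G" "v \<in> pverts G"
            using that G card by auto
          ultimately show ?thesis
            using f that f' unfolding list_colouring_def trigraph_hom_def compat_def A_def S_def by auto
        qed
        ultimately show "\<exists>f. solution f"
          using f' by (intro exI[of _ f']) (auto simp: solution_def)
      qed
      moreover have "fst (run ?l (main_com k A S) (?e, ?m)) 0 = 1 \<longleftrightarrow> (\<exists>f. solution f)"
        by (rule run_main_well_formed) (use n in auto)
      ultimately show ?thesis
        by simp
    qed
  qed
qed

end
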